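(* Let $q$ and $\lambda$ be generic and $\mu=(\mu_1,\dots,\mu_r)\in(\mathbb C^* )^r$. The Whittaker vector $|w\rangle$ of $U_q(\mathfrak{sl}_{r+1})$ in the completion of $V_\lambda$ (the unique element with $\langle\lambda|w\rangle=1$ and $E_i|w\rangle=\mu_i(K_i)^{i-1}|w\rangle$ for $i=1,\dots,r$) is $$|w\rangle=\sum_{\beta\in Q_+}\Big(\prod_{i=1}^r\mu_i^{\beta_i}\Big)|Z_\beta\rangle,\qquad |Z_\beta\rangle=\sum_{\mathbf p\in\mathcal P_\beta}x_q(\mathbf p)\,|\mathbf p\rangle,$$ where $\beta=\sum_i\beta_i\alpha_i$ and, for $\mathbf p=(p_0,\dots,p_N)$ with $p_k-p_{k-1}=\alpha_{i_k}$, $x_q(\mathbf p)=\prod_{k=1}^N\frac1{v^{(i_k)}(p_k)}$.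
   Context: Roots and weights. $C$ is the Cartan matrix of $\mathfrak{sl}_{r+1}$ (type $A_r$), $\alpha_1,\dots,\alpha_r$ the simple roots with $(\alpha_i|\alpha_j)=C_{i,j}$, $\omega_i$ the fundamental weights, $(\omega_i|\alpha_j)=\delta_{i,j}$, $\omega_0=\omega_{r+1}=0$, $\rho=\sum_i\omega_i$, $Q_+=\bigoplus_i\mathbb Z_{\ge0}\alpha_i$, $\lambda_i=(\lambda|\alpha_i)$. Algebra. $U_q(\mathfrak{sl}_{r+1})$ is generated by $E_i,F_i,K_i^{\pm1}$, $1\le i\le r$, with commuting $K_i$'s and $[E_i,F_j]=\delta_{i,j}\frac{K_i-K_i^{-1}}{q-q^{-1}}$, $K_iE_j=q^{C_{j,i}}E_jK_i$, $K_iF_j=q^{-C_{j,i}}F_jK_i$, and the quantum Serre relations $E_i^2E_j-(q+q^{-1})E_iE_jE_i+E_jE_i^2=0$, $F_i^2F_j-(q+q^{-1})F_iF_jF_i+F_jF_i^2=0$ for $j=i\pm1$, $[E_i,E_j]=[F_i,F_j]=0$ for $|i-j|>1$. $V_\lambda$ is the (irreducible) Verma module generated by the $F_i$ from $|\lambda\rangle$ with $E_i|\lambda\rangle=0$, $K_i|\lambda\rangle=q^{\lambda_i}|\lambda\rangle$; its completion is the product of its weight spaces $V[\lambda-\beta]$, $\beta\in Q_+$, and $\langle\lambda|$ is the functional equal to $1$ on $|\lambda\rangle$ and $0$ on the other weight spaces. Paths. $\mathcal P_\beta$ is the set of sequences $\mathbf p=(p_0,\dots,p_N)$ in $Q_+$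 with $p_0=0$, $p_N=\beta$, $p_k-p_{k-1}=\alpha_{i_k}$ simple roots. With $\overline F_i=F_i(K_i)^{i-1}$, set $|\mathbf p\rangle=\overline F_{i_N}\overline F_{i_{N-1}}\cdots\overline F_{i_1}|\lambda\rangle$. Weights. $v_q(\beta)=\frac1{(q-q^{-1})^2}\sum_{i=0}^rq^{2(\lambda+\rho|\omega_i-\omega_{i+1})}\big(1-q^{2(\beta|\omega_{i+1}-\omega_i)}\big)$, $\tau_i(\beta)=(\lambda+\rho-\beta|\omega_{i+1}-\omega_{i-1})$, $v^{(i)}(\beta)=q^{\tau_i(\beta)}v_q(\beta)$. The trivial path has weight $1$. A determination of $\log q$ is fixed so that $q^x$ is defined. "Generic" means $q\neq0$ is not a root of unity, $V_\lambda$ is irreducible, and $v_q(\beta)\ne0$ for all $\beta\in Q_+\setminus\{0\}$. *)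

theory Defs
  imports
    Complex_Main
    "HOL-Library.Function_Algebras"
    "HOL-Library.Poly_Mapping"
begin

section \<open>Roots and weights of type A\<close>

text \<open>
  A weight is given by its coordinates in the basis of simple roots: \<open>x :: nat \<Rightarrow> complex\<close> stands
  for \<open>\<Sum>i=1..r. x i \<alpha>\<^sub>i\<close>, and coordinates outside \<open>{1..r}\<close> are ignored by \<open>wform r\<close>.
  Elements of the positive cone \<open>Q\<^sub>+\<close> have natural number coordinates; \<open>wt\<close> is the embedding.
\<close>

definition cartan :: "nat \<Rightarrow> nat \<Rightarrow> int" where
  "cartan i j = (if i = j then 2 else if i = Suc j \<or> j = Suc i then -1 else 0)"

definition wform :: "nat \<Rightarrow> (nat \<Rightarrow> complex) \<Rightarrow> (nat \<Rightarrow> complex) \<Rightarrow> complex" where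
  "wform r x y = (\<Sum>i=1..r. \<Sum>j=1..r. x i * of_int (cartan i j) * y j)"

definition sroot :: "nat \<Rightarrow> nat \<Rightarrow> nat" where
  "sroot i = (\<lambda>j. if j = i then 1 else 0)"

definition wt :: "(nat \<Rightarrow> nat) \<Rightarrow> nat \<Rightarrow> complex" where
  "wt \<beta> = (\<lambda>i. of_nat (\<beta> i))"

definition Qplus :: "nat \<Rightarrow> (nat \<Rightarrow> nat) set" where
  "Qplus r = {\<beta>. \<forall>i. i \<notin> {1..r} \<longrightarrow> \<beta> i = 0}"

text \<open>
  The coordinates of the fundamental weights are the entries of the inverse Cartan matrix; the
  lemmas \<open>fweight_sroot\<close> and \<open>fweight_boundary\<close> check the defining properties.
\<close>

definition fweight :: "nat \<Rightarrow> nat \<Rightarrow> nat \<Rightarrow> complex" where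
  "fweight r i = (\<lambda>j. if j \<in> {1..r}
     then of_nat (min i j) - of_nat (i * j) / of_nat (r + 1) else 0)"

definition rho :: "nat \<Rightarrow> nat \<Rightarrow> complex" where
  "rho r = (\<Sum>i=1..r. fweight r i)"

lemma fweight_boundary: "fweight r 0 = 0" "fweight r (r + 1) = 0"
proof -
  have nz: "of_nat (r + 1) \<noteq> (0 :: complex)"
    by (subst of_nat_eq_0_iff) simp
  show "fweight r 0 = 0"
    by (simp add: fweight_def fun_eq_iff)
  have "of_nat (min (r + 1) j) - of_nat ((r + 1) * j) / of_nat (r + 1) = (0 :: complex)"
    if "j \<in> {1..r}" for j
  proof -
    have "min (r + 1) j = j"
      using that by simp
    then show ?thesis
      using nz by (simp only: of_nat_mult nonzero_mult_div_cancel_left) simp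
  qed
  then show "fweight r (r + 1) = 0"
    by (auto simp only: fweight_def fun_eq_iff zero_fun_apply split: if_split)
qed

lemma cartan_column_sum:
  fixes f :: "nat \<Rightarrow> complex"
  assumes "j \<in> {1..r}" "f 0 = 0" "f (r + 1) = 0"
  shows "(\<Sum>i=1..r. f i * of_int (cartan i j)) = 2 * f j - f (j - 1) - f (j + 1)"
proof -
  have "(\<Sum>i=1..r. f i * of_int (cartan i j)) = (\<Sum>i=0..r+1. f i * of_int (cartan i j))"
  proof (rule sum.mono_neutral_left)
    show "\<forall>i\<in>{0..r + 1} - {1..r}. f i * of_int (cartan i j) = 0"
    proof
      fix i assume "i \<in> {0..r + 1} - {1..r}"
      then have "i = 0 \<or> i = r + 1"
        by auto
      with assms show "f i * of_int (cartan i j) = 0"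
        by auto
    qed
  qed auto
  also have "\<dots> = (\<Sum>i\<in>{j - 1, j, j + 1}. f i * of_int (cartan i j))"
    using assms(1) by (intro sum.mono_neutral_right) (auto simp: cartan_def)
  also have "\<dots> = 2 * f j - f (j - 1) - f (j + 1)"
    using assms(1) by (subst sum.insert; auto simp: cartan_def)+
  finally show ?thesis .
qed

lemma wform_sroot:
  assumes "j \<in> {1..r}"
  shows "wform r x (wt (sroot j)) = (\<Sum>i=1..r. x i * of_int (cartan i j))"
proof -
  have "(\<Sum>k=1..r. x i * of_int (cartan i k) * wt (sroot j) k) = x i * of_int (cartan i j)" for i
  proof -
    have "(\<Sum>k=1..r. x i * of_int (cartan i k) * wt (sroot j) k)
        = (\<Sum>k=1..r. if k = j then x i * of_int (cartan i k) else 0)"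
      by (intro sum.cong) (auto simp: wt_def sroot_def)
    then show ?thesis
      using assms by simp
  qed
  then show ?thesis
    by (simp add: wform_def)
qed

lemma wform_sroot_sroot:
  assumes "i \<in> {1..r}" "j \<in> {1..r}"
  shows "wform r (wt (sroot i)) (wt (sroot j)) = of_int (cartan i j)"
proof -
  have "(\<Sum>k=1..r. wt (sroot i) k * of_int (cartan k j))
      = (\<Sum>k=1..r. if k = i then complex_of_int (cartan k j) else 0)"
    by (intro sum.cong) (auto simp: wt_def sroot_def)
  then show ?thesis
    using assms by (simp add: wform_sroot)
qed

lemma fweight_sroot:
  assumes "i \<in> {1..r}" "j \<in> {1..r}"
  shows "wform r (fweight r i) (wt (sroot j)) = (if i = j then 1 else 0)"
proof -
  define c :: complex where "c = of_nat i / of_nat (r + 1)"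
  define f :: "nat \<Rightarrow> complex" where "f = (\<lambda>k. of_nat (min i k) - c * of_nat k)"
  have c: "c * of_nat (r + 1) = of_nat i"
  proof -
    have "of_nat (r + 1) \<noteq> (0 :: complex)"
      by (subst of_nat_eq_0_iff) simp
    from nonzero_mult_div_cancel_right[OF this, of "of_nat i"] show ?thesis
      by (simp only: c_def times_divide_eq_left)
  qed
  have "wform r (fweight r i) (wt (sroot j)) = (\<Sum>k=1..r. f k * of_int (cartan k j))"
    unfolding wform_sroot[OF assms(2)] f_def c_def fweight_def by (intro sum.cong) auto
  also have "\<dots> = 2 * f j - f (j - 1) - f (j + 1)"
  proof (rule cartan_column_sum[OF assms(2)])
    have "min i (r + 1) = i"
      using assms by simp
    then show "f (r + 1) = 0"
      by (simp only: f_def c diff_self)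
  qed (simp add: f_def)
  also have "\<dots> = 2 * of_nat (min i j) - of_nat (min i (j - 1)) - of_nat (min i (j + 1))"
    using assms by (simp add: f_def of_nat_diff algebra_simps)
  also have "\<dots> = (if i = j then 1 else 0)"
  proof -
    obtain m where m: "j = Suc m"
      using assms by (cases j) auto
    show ?thesis
      unfolding m by (cases "i \<le> m"; cases "i = Suc m") (auto simp: min_def le_Suc_eq)
  qed
  finally show ?thesis .
qed


section \<open>The algebra\<close>

text \<open>
  The free associative algebra on the letters \<open>'g\<close> is the monoid algebra
  \<open>'g free_mon \<Rightarrow>\<^sub>0 complex\<close> of the free monoid.
\<close>

datatype 'g free_mon = Free_Mon (letters: "'g list")

instantiation free_mon :: (type) monoid_add
begin
definition zero_free_mon :: "'a free_mon" where "zero_free_mon = Free_Mon []"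
definition plus_free_mon :: "'a free_mon \<Rightarrow> 'a free_mon \<Rightarrow> 'a free_mon" where
  "plus_free_mon u v = Free_Mon (letters u @ letters v)"
instance by standard (auto simp: zero_free_mon_def plus_free_mon_def)
end

datatype uqgen = GE nat | GF nat | GK nat | GKinv nat

type_synonym freealg = "uqgen free_mon \<Rightarrow>\<^sub>0 complex"

definition const :: "complex \<Rightarrow> freealg" where
  "const c = Poly_Mapping.single 0 c"

definition gen :: "uqgen \<Rightarrow> freealg" where
  "gen g = Poly_Mapping.single (Free_Mon [g]) 1"

abbreviation "Eg i \<equiv> gen (GE i)"
abbreviation "Fg i \<equiv> gen (GF i)"
abbreviation "Kg i \<equiv> gen (GK i)"
abbreviation "Kig i \<equiv> gen (GKinv i)"

text \<open>
  The quantised enveloping algebra of rank \<open>r\<close> is presented as the quotient of the free algebra by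
  the elements below. The letters are indexed by all natural numbers; the first rule removes the
  superfluous ones by setting them to zero.
\<close>

inductive_set uq_rels :: "nat \<Rightarrow> complex \<Rightarrow> freealg set" for r :: nat and q :: complex where
  unused: "i \<notin> {1..r} \<Longrightarrow> g \<in> {GE i, GF i, GK i, GKinv i} \<Longrightarrow> gen g \<in> uq_rels r q"
| KKinv: "i \<in> {1..r} \<Longrightarrow> Kg i * Kig i - 1 \<in> uq_rels r q"
| KinvK: "i \<in> {1..r} \<Longrightarrow> Kig i * Kg i - 1 \<in> uq_rels r q"
| KK: "i \<in> {1..r} \<Longrightarrow> j \<in> {1..r} \<Longrightarrow> Kg i * Kg j - Kg j * Kg i \<in> uq_rels r q"
| KE: "i \<in> {1..r} \<Longrightarrow> j \<in> {1..r} \<Longrightarrow>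
    Kg i * Eg j - const (q powi cartan j i) * Eg j * Kg i \<in> uq_rels r q"
| KF: "i \<in> {1..r} \<Longrightarrow> j \<in> {1..r} \<Longrightarrow>
    Kg i * Fg j - const (q powi (- cartan j i)) * Fg j * Kg i \<in> uq_rels r q"
| EF: "i \<in> {1..r} \<Longrightarrow> j \<in> {1..r} \<Longrightarrow>
    Eg i * Fg j - Fg j * Eg i
      - (if i = j then const (1 / (q - inverse q)) * (Kg i - Kig i) else 0) \<in> uq_rels r q"
| SerreE: "i \<in> {1..r} \<Longrightarrow> j \<in> {1..r} \<Longrightarrow> j = Suc i \<or> i = Suc j \<Longrightarrow>
    Eg i ^ 2 * Eg j - const (q + inverse q) * Eg i * Eg j * Eg i + Eg j * Eg i ^ 2 \<in> uq_rels r q"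
| SerreF: "i \<in> {1..r} \<Longrightarrow> j \<in> {1..r} \<Longrightarrow> j = Suc i \<or> i = Suc j \<Longrightarrow>
    Fg i ^ 2 * Fg j - const (q + inverse q) * Fg i * Fg j * Fg i + Fg j * Fg i ^ 2 \<in> uq_rels r q"
| EE: "i \<in> {1..r} \<Longrightarrow> j \<in> {1..r} \<Longrightarrow> Suc i < j \<or> Suc j < i \<Longrightarrow>
    Eg i * Eg j - Eg j * Eg i \<in> uq_rels r q"
| FF: "i \<in> {1..r} \<Longrightarrow> j \<in> {1..r} \<Longrightarrow> Suc i < j \<or> Suc j < i \<Longrightarrow>
    Fg i * Fg j - Fg j * Fg i \<in> uq_rels r q"


section \<open>Modules\<close>

definition uq_module ::
  "nat \<Rightarrow> complex \<Rightarrow> (complex \<Rightarrow> 'v::ab_group_add \<Rightarrow> 'v) \<Rightarrow> (freealg \<Rightarrow> 'v \<Rightarrow> 'v) \<Rightarrow> bool" where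
  "uq_module r q scale act \<longleftrightarrow>
     vector_space scale \<and>
     (\<forall>c v. act (const c) v = scale c v) \<and>
     (\<forall>x y v. act (x * y) v = act x (act y v)) \<and>
     (\<forall>x y v. act (x + y) v = act x v + act y v) \<and>
     (\<forall>x u v. act x (u + v) = act x u + act x v) \<and>
     (\<forall>x\<in>uq_rels r q. \<forall>v. act x v = 0)"

definition irreducible_module ::
  "(complex \<Rightarrow> 'v::ab_group_add \<Rightarrow> 'v) \<Rightarrow> (freealg \<Rightarrow> 'v \<Rightarrow> 'v) \<Rightarrow> bool" where
  "irreducible_module scale act \<longleftrightarrow>
     (\<exists>v::'v. v \<noteq> 0) \<and>
     (\<forall>W. module.subspace scale W \<and> (\<forall>x. \<forall>w\<in>W. act x w \<in> W) \<longrightarrow> W = {0} \<or> W = UNIV)"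

text \<open>\<open>h\<close> is the chosen determination of \<open>log q\<close>, so that \<open>exp h = q\<close>.\<close>

definition qpow :: "complex \<Rightarrow> complex \<Rightarrow> complex" where
  "qpow h x = exp (x * h)"

text \<open>
  The Verma module is the cyclic module \<open>U/J\<close>, where \<open>J\<close> is the left ideal generated by the \<open>E\<^sub>i\<close>
  and the \<open>K\<^sub>i - q\<^bsup>\<Lambda>\<^sub>i\<^esup>\<close>; \<open>verma_ideal\<close> is the preimage of \<open>J\<close> in the free algebra.
  The module is determined up to isomorphism by requiring this to be the annihilator of a
  generator \<open>vl\<close>.
\<close>

inductive_set verma_ideal :: "nat \<Rightarrow> complex \<Rightarrow> complex \<Rightarrow> (nat \<Rightarrow> complex) \<Rightarrow> freealg set"
  for r :: nat and q h :: complex and \<Lambda> :: "nat \<Rightarrow> complex" where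
  zero: "0 \<in> verma_ideal r q h \<Lambda>"
| add: "x \<in> verma_ideal r q h \<Lambda> \<Longrightarrow> y \<in> verma_ideal r q h \<Lambda> \<Longrightarrow> x + y \<in> verma_ideal r q h \<Lambda>"
| rel: "x \<in> uq_rels r q \<Longrightarrow> a * x * b \<in> verma_ideal r q h \<Lambda>"
| E: "i \<in> {1..r} \<Longrightarrow> a * Eg i \<in> verma_ideal r q h \<Lambda>"
| K: "i \<in> {1..r} \<Longrightarrow>
    a * (Kg i - const (qpow h (wform r \<Lambda> (wt (sroot i))))) \<in> verma_ideal r q h \<Lambda>"

definition verma_module ::
  "nat \<Rightarrow> complex \<Rightarrow> complex \<Rightarrow> (nat \<Rightarrow> complex) \<Rightarrow> (complex \<Rightarrow> 'v::ab_group_add \<Rightarrow> 'v) \<Rightarrow>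
     (freealg \<Rightarrow> 'v \<Rightarrow> 'v) \<Rightarrow> 'v \<Rightarrow> bool" where
  "verma_module r q h \<Lambda> scale act vl \<longleftrightarrow>
     uq_module r q scale act \<and>
     (\<forall>v. \<exists>x. v = act x vl) \<and>
     {x. act x vl = 0} = verma_ideal r q h \<Lambda>"

definition weight_space ::
  "nat \<Rightarrow> complex \<Rightarrow> (complex \<Rightarrow> 'v \<Rightarrow> 'v) \<Rightarrow> (freealg \<Rightarrow> 'v \<Rightarrow> 'v) \<Rightarrow>
     (nat \<Rightarrow> complex) \<Rightarrow> 'v set" where
  "weight_space r h scale act \<nu> =
     {v. \<forall>i\<in>{1..r}. act (Kg i) v = scale (qpow h (wform r \<nu> (wt (sroot i)))) v}"

text \<open>
  An element of the completion is the family of its components \<open>w \<beta> \<in> V[\<Lambda> - \<beta>]\<close>, extended by \<open>0\<close>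
  outside \<open>Q\<^sub>+\<close>.
\<close>

definition completion ::
  "nat \<Rightarrow> complex \<Rightarrow> (nat \<Rightarrow> complex) \<Rightarrow> (complex \<Rightarrow> 'v::zero \<Rightarrow> 'v) \<Rightarrow>
     (freealg \<Rightarrow> 'v \<Rightarrow> 'v) \<Rightarrow> ((nat \<Rightarrow> nat) \<Rightarrow> 'v) set" where
  "completion r h \<Lambda> scale act =
     {w. (\<forall>\<beta>\<in>Qplus r. w \<beta> \<in> weight_space r h scale act (\<Lambda> - wt \<beta>)) \<and>
         (\<forall>\<beta>. \<beta> \<notin> Qplus r \<longrightarrow> w \<beta> = 0)}"

text \<open>
  The functional \<open>\<langle>\<Lambda>|\<close> only sees the component in \<open>V[\<Lambda>]\<close>, which is spanned by the highest weight
  vector \<open>vl\<close>, and reads off the coefficient of \<open>vl\<close>.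
\<close>

definition bra :: "(complex \<Rightarrow> 'v \<Rightarrow> 'v) \<Rightarrow> 'v \<Rightarrow> ((nat \<Rightarrow> nat) \<Rightarrow> 'v) \<Rightarrow> complex" where
  "bra scale vl w = (THE c. w 0 = scale c vl)"

text \<open>\<open>E\<^sub>i\<close> maps \<open>V[\<Lambda> - \<beta> - \<alpha>\<^sub>i]\<close> to \<open>V[\<Lambda> - \<beta>]\<close>, while \<open>K\<^sub>i\<close> preserves weight spaces.\<close>

definition compl_E ::
  "(freealg \<Rightarrow> 'v \<Rightarrow> 'v) \<Rightarrow> nat \<Rightarrow> ((nat \<Rightarrow> nat) \<Rightarrow> 'v) \<Rightarrow> (nat \<Rightarrow> nat) \<Rightarrow> 'v" where
  "compl_E act i w = (\<lambda>\<beta>. act (Eg i) (w (\<beta> + sroot i)))"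

definition compl_K ::
  "(freealg \<Rightarrow> 'v \<Rightarrow> 'v) \<Rightarrow> nat \<Rightarrow> ((nat \<Rightarrow> nat) \<Rightarrow> 'v) \<Rightarrow> (nat \<Rightarrow> nat) \<Rightarrow> 'v" where
  "compl_K act i w = (\<lambda>\<beta>. act (Kg i) (w \<beta>))"

definition whittaker_vector ::
  "nat \<Rightarrow> complex \<Rightarrow> (nat \<Rightarrow> complex) \<Rightarrow> (complex \<Rightarrow> 'v::ab_group_add \<Rightarrow> 'v) \<Rightarrow>
     (freealg \<Rightarrow> 'v \<Rightarrow> 'v) \<Rightarrow> 'v \<Rightarrow> (nat \<Rightarrow> complex) \<Rightarrow> ((nat \<Rightarrow> nat) \<Rightarrow> 'v) \<Rightarrow> bool" where
  "whittaker_vector r h \<Lambda> scale act vl \<mu> w \<longleftrightarrow>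
     w \<in> completion r h \<Lambda> scale act \<and>
     bra scale vl w = 1 \<and>
     (\<forall>i\<in>{1..r}. compl_E act i w = (\<lambda>\<beta>. scale (\<mu> i) ((compl_K act i ^^ (i - 1)) w \<beta>)))"


section \<open>Paths and their weights\<close>

definition paths :: "nat \<Rightarrow> (nat \<Rightarrow> nat) \<Rightarrow> (nat \<Rightarrow> nat) list set" where
  "paths r \<beta> = {p. p \<noteq> [] \<and> set p \<subseteq> Qplus r \<and> hd p = 0 \<and> last p = \<beta> \<and>
     (\<forall>k. 1 \<le> k \<and> k < length p \<longrightarrow> (\<exists>i\<in>{1..r}. p ! k = p ! (k - 1) + sroot i))}"

lemma path_nth:
  assumes p: "p \<in> paths r \<beta>" and k: "k < length p"
  shows "p ! k \<le> \<beta>" "(\<Sum>i=1..r. (p ! k) i) = k"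
proof -
  have step: "\<exists>i\<in>{1..r}. p ! Suc k = p ! k + sroot i" if "Suc k < length p" for k
    using p that by (force simp: paths_def dest: spec[of _ "Suc k"])
  show "(\<Sum>i=1..r. (p ! k) i) = k"
    using k
  proof (induction k)
    case 0
    then show ?case
      using p by (simp add: paths_def hd_conv_nth)
  next
    case (Suc k)
    then obtain i where "i \<in> {1..r}" "p ! Suc k = p ! k + sroot i"
      using step by blast
    with Suc show ?case
      by (simp add: sum.distrib sroot_def)
  qed
  have "p ! k \<le> p ! (length p - 1)" if "k \<le> length p - 1" for k
    using that
  proof (induction k rule: inc_induct)
    case (step n)
    then have "Suc n < length p"
      by simp
    then obtain i where "p ! Suc n = p ! n + sroot i"
      using \<open>\<And>k. Suc k < length p \<Longrightarrow> \<exists>i\<in>{1..r}. p ! Suc k = p ! k + sroot i\<close> by blast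
    then have "p ! n \<le> p ! Suc n"
      by (simp add: le_fun_def)
    with step.IH show ?case
      by simp
  qed simp
  with k p show "p ! k \<le> \<beta>"
    by (auto simp: paths_def last_conv_nth)
qed

lemma finite_paths: "finite (paths r \<beta>)"
proof -
  define B where "B = {\<gamma> \<in> Qplus r. \<gamma> \<le> \<beta>}"
  have "B \<subseteq> {\<gamma>. \<forall>i. (i \<in> {1..r} \<longrightarrow> \<gamma> i \<in> {..Max (\<beta> ` {1..r})}) \<and> (i \<notin> {1..r} \<longrightarrow> \<gamma> i = 0)}"
  proof
    fix \<gamma> assume \<gamma>: "\<gamma> \<in> B"
    have "\<gamma> i \<le> Max (\<beta> ` {1..r})" if "i \<in> {1..r}" for i
    proof -
      have "\<gamma> i \<le> \<beta> i"
        using \<gamma> by (simp add: B_def le_fun_def)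
      also have "\<beta> i \<le> Max (\<beta> ` {1..r})"
        using that by (intro Max_ge) auto
      finally show ?thesis .
    qed
    with \<gamma> show "\<gamma> \<in> {\<gamma>. \<forall>i. (i \<in> {1..r} \<longrightarrow> \<gamma> i \<in> {..Max (\<beta> ` {1..r})}) \<and>
        (i \<notin> {1..r} \<longrightarrow> \<gamma> i = 0)}"
      by (simp add: B_def Qplus_def)
  qed
  then have "finite B"
    by (rule finite_subset) (rule finite_set_of_finite_funs, simp_all)
  moreover have "set p \<subseteq> B \<and> length p \<le> Suc (\<Sum>i=1..r. \<beta> i)" if "p \<in> paths r \<beta>" for p
  proof
    show "set p \<subseteq> B"
      using that path_nth(1)[OF that] by (force simp: B_def paths_def in_set_conv_nth)
    have "length p - 1 < length p" "p ! (length p - 1) = \<beta>"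
      using that by (auto simp: paths_def last_conv_nth)
    with path_nth(2)[OF that, of "length p - 1"] show "length p \<le> Suc (\<Sum>i=1..r. \<beta> i)"
      by simp
  qed
  ultimately show ?thesis
    by (intro finite_subset[OF _ finite_lists_length_le]) auto
qed

text \<open>The index \<open>i\<^sub>k\<close> of the \<open>k\<close>-th step.\<close>

definition step_index :: "nat \<Rightarrow> (nat \<Rightarrow> nat) list \<Rightarrow> nat \<Rightarrow> nat" where
  "step_index r p k = (THE i. i \<in> {1..r} \<and> p ! k = p ! (k - 1) + sroot i)"

lemma step_index_eq:
  assumes "i \<in> {1..r}" "p ! k = p ! (k - 1) + sroot i"
  shows "step_index r p k = i"
  unfolding step_index_def
proof (rule the_equality)
  fix j assume "j \<in> {1..r} \<and> p ! k = p ! (k - 1) + sroot j"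
  with assms have "sroot j = sroot i"
    by simp
  then show "j = i"
    by (metis sroot_def zero_neq_one)
qed (use assms in simp)

definition Fbar :: "nat \<Rightarrow> freealg" where
  "Fbar i = Fg i * Kg i ^ (i - 1)"

definition path_vector :: "nat \<Rightarrow> (freealg \<Rightarrow> 'v \<Rightarrow> 'v) \<Rightarrow> 'v \<Rightarrow> (nat \<Rightarrow> nat) list \<Rightarrow> 'v" where
  "path_vector r act vl p = fold (\<lambda>k. act (Fbar (step_index r p k))) [1..<length p] vl"

definition vq :: "nat \<Rightarrow> complex \<Rightarrow> complex \<Rightarrow> (nat \<Rightarrow> complex) \<Rightarrow> (nat \<Rightarrow> nat) \<Rightarrow> complex" where
  "vq r q h \<Lambda> \<beta> = 1 / (q - inverse q) ^ 2 *
     (\<Sum>i=0..r. qpow h (2 * wform r (\<Lambda> + rho r) (fweight r i - fweight r (i + 1))) *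
        (1 - qpow h (2 * wform r (wt \<beta>) (fweight r (i + 1) - fweight r i))))"

definition tau :: "nat \<Rightarrow> (nat \<Rightarrow> complex) \<Rightarrow> nat \<Rightarrow> (nat \<Rightarrow> nat) \<Rightarrow> complex" where
  "tau r \<Lambda> i \<beta> = wform r (\<Lambda> + rho r - wt \<beta>) (fweight r (i + 1) - fweight r (i - 1))"

definition vi :: "nat \<Rightarrow> complex \<Rightarrow> complex \<Rightarrow> (nat \<Rightarrow> complex) \<Rightarrow> nat \<Rightarrow> (nat \<Rightarrow> nat) \<Rightarrow> complex" where
  "vi r q h \<Lambda> i \<beta> = qpow h (tau r \<Lambda> i \<beta>) * vq r q h \<Lambda> \<beta>"

definition path_weight ::
  "nat \<Rightarrow> complex \<Rightarrow> complex \<Rightarrow> (nat \<Rightarrow> complex) \<Rightarrow> (nat \<Rightarrow> nat) list \<Rightarrow> complex" where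
  "path_weight r q h \<Lambda> p = (\<Prod>k=1..<length p. 1 / vi r q h \<Lambda> (step_index r p k) (p ! k))"

definition Zvec ::
  "nat \<Rightarrow> complex \<Rightarrow> complex \<Rightarrow> (nat \<Rightarrow> complex) \<Rightarrow> (complex \<Rightarrow> 'v::ab_group_add \<Rightarrow> 'v) \<Rightarrow>
     (freealg \<Rightarrow> 'v \<Rightarrow> 'v) \<Rightarrow> 'v \<Rightarrow> (nat \<Rightarrow> nat) \<Rightarrow> 'v" where
  "Zvec r q h \<Lambda> scale act vl \<beta> =
     (\<Sum>p\<in>paths r \<beta>. scale (path_weight r q h \<Lambda> p) (path_vector r act vl p))"

text \<open>
  The formal sum \<open>\<Sum>\<beta>\<in>Q\<^sub>+. (\<Prod>i=1..r. \<mu>\<^sub>i\<^bsup>\<beta>\<^sub>i\<^esup>) Z\<^sub>\<beta>\<close> is the element of the completion whose component in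
  \<open>V[\<Lambda> - \<beta>]\<close> is the summand indexed by \<open>\<beta>\<close>.
\<close>

definition path_sum ::
  "nat \<Rightarrow> complex \<Rightarrow> complex \<Rightarrow> (nat \<Rightarrow> complex) \<Rightarrow> (complex \<Rightarrow> 'v::ab_group_add \<Rightarrow> 'v) \<Rightarrow>
     (freealg \<Rightarrow> 'v \<Rightarrow> 'v) \<Rightarrow> 'v \<Rightarrow> (nat \<Rightarrow> complex) \<Rightarrow> (nat \<Rightarrow> nat) \<Rightarrow> 'v" where
  "path_sum r q h \<Lambda> scale act vl \<mu> = (\<lambda>\<beta>. if \<beta> \<in> Qplus r
     then scale (\<Prod>i=1..r. \<mu> i ^ \<beta> i) (Zvec r q h \<Lambda> scale act vl \<beta>) else 0)"

definition generic ::
  "nat \<Rightarrow> complex \<Rightarrow> complex \<Rightarrow> (nat \<Rightarrow> complex) \<Rightarrow> (complex \<Rightarrow> 'v::ab_group_add \<Rightarrow> 'v) \<Rightarrow>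
     (freealg \<Rightarrow> 'v \<Rightarrow> 'v) \<Rightarrow> bool" where
  "generic r q h \<Lambda> scale act \<longleftrightarrow>
     q \<noteq> 0 \<and> (\<forall>n>0. q ^ n \<noteq> 1) \<and>
     irreducible_module scale act \<and>
     (\<forall>\<beta>\<in>Qplus r - {0}. vq r q h \<Lambda> \<beta> \<noteq> 0)"

end

theory Submission
  imports Defs
begin

text \<open>
  By the recursion on the last step of a path,
  \<open>Z\<^sub>\<beta> = \<Sum>\<^sub>i v\<^bsup>(i)\<^esup>(\<beta>)\<^bsup>-1\<^esup> F\<^sub>i K\<^sub>i\<^bsup>i-1\<^esup> Z\<^bsub>\<beta>-\<alpha>\<^sub>i\<^esub>\<close>.
  Applying \<open>E\<^sub>j\<close> and commuting it to the right, the Whittaker equation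
  \<open>E\<^sub>j Z\<^sub>\<beta> = K\<^sub>j\<^bsup>j-1\<^esup> Z\<^bsub>\<beta>-\<alpha>\<^sub>j\<^esub>\<close> follows by induction on the height of \<open>\<beta>\<close>. Two identities make this
  work: the factors \<open>q\<^bsup>\<tau>\<^sub>i\<^esup>\<close> compensate for moving \<open>E\<^sub>j\<close> past \<open>K\<^sub>i\<^bsup>i-1\<^esup>\<close> and \<open>K\<^sub>j\<^bsup>j-1\<^esup>\<close> past \<open>F\<^sub>i\<close>, and the
  difference \<open>v\<^sub>q(\<beta>) - v\<^sub>q(\<beta> - \<alpha>\<^sub>j)\<close> is \<open>q\<^bsup>-\<tau>\<^sub>j(\<beta>)\<^esup>\<close> times the eigenvalue of \<open>[E\<^sub>j, F\<^sub>j]\<close> on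
  \<open>V[\<Lambda> - \<beta> + \<alpha>\<^sub>j]\<close>. Uniqueness holds because the lowest nonzero component of the difference of two
  Whittaker vectors is a singular vector; away from weight \<open>\<Lambda>\<close> such a vector would generate a proper
  submodule.
\<close>

section \<open>Weights and the function \<open>v\<^sub>q\<close>\<close>

lemma qpow_add: "qpow h (a + b) = qpow h a * qpow h b"
  by (simp add: qpow_def ring_distribs exp_add)

lemma qpow_minus: "qpow h (- a) = inverse (qpow h a)"
  by (simp add: qpow_def exp_minus)

lemma qpow_diff: "qpow h (a - b) = qpow h a / qpow h b"
  by (simp add: qpow_def left_diff_distrib exp_diff)

lemma qpow_0 [simp]: "qpow h 0 = 1"
  by (simp add: qpow_def)

lemma qpow_1: "qpow h 1 = exp h"
  by (simp add: qpow_def)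

lemma qpow_nonzero [simp]: "qpow h a \<noteq> 0"
  by (simp add: qpow_def)

lemma qpow_power: "qpow h a ^ n = qpow h (of_nat n * a)"
  by (simp add: qpow_def mult.assoc flip: exp_of_nat_mult)

lemma qpow_of_int: "qpow h (of_int n) = exp h powi n"
  by (simp add: qpow_def exp_power_int)

section \<open>The bilinear form and its values on simple roots and fundamental weights\<close>

lemma wform_add_left: "wform r (x + y) z = wform r x z + wform r y z"
  by (simp add: wform_def sum.distrib ring_distribs)

lemma wform_add_right: "wform r z (x + y) = wform r z x + wform r z y"
  by (simp add: wform_def sum.distrib ring_distribs)

lemma wform_diff_left: "wform r (x - y) z = wform r x z - wform r y z"
  by (simp add: wform_def sum_subtractf ring_distribs)

lemma wform_diff_right: "wform r z (x - y) = wform r z x - wform r z y"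
  by (simp add: wform_def sum_subtractf ring_distribs)

lemma wform_zero [simp]: "wform r 0 z = 0" "wform r z 0 = 0"
  by (simp_all add: wform_def)

lemma wform_sum_left: "wform r (\<Sum>a\<in>A. f a) z = (\<Sum>a\<in>A. wform r (f a) z)"
  by (induction A rule: infinite_finite_induct) (simp_all only: sum.infinite sum.empty sum.insert wform_zero wform_add_left not_False_eq_True)

lemma wform_commute: "wform r x y = wform r y x"
  unfolding wform_def by (subst sum.swap) (auto simp: cartan_def intro!: sum.cong)

lemma wform_cong_right:
  assumes "\<And>k. k \<in> {1..r} \<Longrightarrow> y k = z k"
  shows "wform r x y = wform r x z"
  unfolding wform_def using assms by (intro sum.cong refl) auto

lemma fweight_sroot_le:
  assumes "i \<le> Suc r" "j \<in> {1..r}"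
  shows "wform r (fweight r i) (wt (sroot j)) = (if i = j then 1 else 0)"
proof -
  consider "i = 0" | "i = r + 1" | "i \<in> {1..r}"
    using assms by force
  then show ?thesis
    using assms by cases (auto simp: fweight_boundary[simplified] fweight_sroot)
qed

lemma sroot_fweight:
  assumes "i \<le> Suc r" "j \<in> {1..r}"
  shows "wform r (wt (sroot j)) (fweight r i) = (if i = j then 1 else 0)"
  using fweight_sroot_le[OF assms] by (simp add: wform_commute)

lemma rho_sroot:
  assumes "j \<in> {1..r}"
  shows "wform r (rho r) (wt (sroot j)) = 1"
  using assms by (simp add: rho_def wform_sum_left fweight_sroot)

text \<open>A simple root is a second difference of fundamental weights. The linear part of
  \<open>fweight r i k\<close> in \<open>i\<close> cancels, and only the kink of
  \<open>min i k\<close> at \<open>i = k\<close> survives. The coordinate formula is uniform in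
  \<open>i\<close>, so the ends \<open>j = 1\<close> and \<open>j = r\<close> need no separate
  treatment.\<close>

lemma wform_sroot_fweight:
  assumes "j \<in> {1..r}"
  shows "wform r x (wt (sroot j)) =
    2 * wform r x (fweight r j) - wform r x (fweight r (j + 1)) - wform r x (fweight r (j - 1))"
proof -
  have "wform r x (wt (sroot j)) =
      wform r x (fweight r j + fweight r j - fweight r (j + 1) - fweight r (j - 1))"
  proof (rule wform_cong_right)
    fix k assume k: "k \<in> {1..r}"
    obtain m where m: "j = Suc m"
      using assms by (cases j) auto
    define c :: complex where "c = of_nat k / of_nat (r + 1)"
    have f: "fweight r i k = of_nat (min i k) - of_nat i * c" for i
      using k by (simp add: fweight_def c_def)
    have "of_nat (min j k) + of_nat (min j k) - of_nat (min (j + 1) k) - of_nat (min (j - 1) k)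
        = (wt (sroot j) k :: complex)"
      unfolding m
      by (cases "k \<le> m"; cases "k = Suc m") (auto simp: min_def wt_def sroot_def le_Suc_eq)
    then show "wt (sroot j) k =
        (fweight r j + fweight r j - fweight r (j + 1) - fweight r (j - 1)) k"
      by (simp add: f m algebra_simps)
  qed
  then show ?thesis
    by (simp only: wform_add_right wform_diff_right mult_2)
qed

section \<open>The positive cone and its height function\<close>

lemma wt_add: "wt (\<beta> + \<gamma>) = wt \<beta> + wt \<gamma>"
  by (simp add: wt_def fun_eq_iff)

lemma wt_zero [simp]: "wt 0 = 0"
  by (simp add: wt_def fun_eq_iff)

lemma minus_sroot_add:
  assumes "\<beta> i > 0"
  shows "\<beta> - sroot i + sroot i = \<beta>"
  using assms by (auto simp: sroot_def fun_eq_iff)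

lemma Qplus_add_sroot: "\<beta> \<in> Qplus r \<Longrightarrow> i \<in> {1..r} \<Longrightarrow> \<beta> + sroot i \<in> Qplus r"
  by (auto simp: Qplus_def sroot_def)

lemma Qplus_add_sroot_iff: "i \<in> {1..r} \<Longrightarrow> \<beta> + sroot i \<in> Qplus r \<longleftrightarrow> \<beta> \<in> Qplus r"
  by (auto simp: Qplus_def sroot_def)

lemma Qplus_minus: "\<beta> \<in> Qplus r \<Longrightarrow> \<beta> - \<gamma> \<in> Qplus r"
  by (auto simp: Qplus_def)

lemma zero_Qplus [simp]: "0 \<in> Qplus r"
  by (simp add: Qplus_def)

definition height :: "nat \<Rightarrow> (nat \<Rightarrow> nat) \<Rightarrow> nat" where
  "height r \<beta> = (\<Sum>i=1..r. \<beta> i)"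

lemma height_add_sroot: "i \<in> {1..r} \<Longrightarrow> height r (\<beta> + sroot i) = Suc (height r \<beta>)"
  by (simp add: height_def sum.distrib sroot_def)

lemma height_minus_sroot:
  "i \<in> {1..r} \<Longrightarrow> \<beta> i > 0 \<Longrightarrow> height r (\<beta> - sroot i) < height r \<beta>"
  using height_add_sroot[of i r "\<beta> - sroot i"] by (simp add: minus_sroot_add)

text \<open>This is the nondegeneracy of the Cartan matrix. The coordinates of the difference have
  vanishing second differences, so they are linear in the index; the value 0 at index 0 leaves only
  a slope, and the value 0 at \<open>r + 1\<close> kills it.\<close>

lemma Qplus_eqI_cartan:
  assumes "\<beta> \<in> Qplus r" "\<gamma> \<in> Qplus r"
    and "\<And>j. j \<in> {1..r} \<Longrightarrow> wform r (wt \<beta>) (wt (sroot j)) = wform r (wt \<gamma>) (wt (sroot j))"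
  shows "\<beta> = \<gamma>"
proof -
  define d :: "nat \<Rightarrow> complex" where "d = wt \<beta> - wt \<gamma>"
  have d0: "d i = 0" if "i \<notin> {1..r}" for i
    using that assms(1,2) by (auto simp: d_def wt_def Qplus_def)
  have rec: "d (j + 1) = 2 * d j - d (j - 1)" if "j \<in> {1..r}" for j
  proof -
    have "0 = wform r d (wt (sroot j))"
      using assms(3)[OF that] by (simp add: d_def wform_diff_left)
    also have "\<dots> = 2 * d j - d (j - 1) - d (j + 1)"
      unfolding wform_sroot[OF that] using that d0 by (intro cartan_column_sum) auto
    finally show ?thesis
      by simp
  qed
  \<comment> \<open>The recursion has order two, so the induction carries two consecutive
    values.\<close>
  have lin: "d j = of_nat j * d 1 \<and> d (j + 1) = of_nat (j + 1) * d 1" if "j \<le> r" for j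
    using that
  proof (induction j)
    case (Suc j)
    with rec[of "Suc j"] show ?case
      by (simp add: algebra_simps)
  qed (use d0 in simp)
  have "of_nat (r + 1) * d 1 = 0"
    using lin[of r] d0[of "r + 1"] by simp
  moreover have "of_nat (r + 1) \<noteq> (0 :: complex)"
    by (subst of_nat_eq_0_iff) simp
  ultimately have "d 1 = 0"
    by simp
  then have "d j = 0" if "j \<le> r" for j
    using lin[OF that] by simp
  with d0 have "d j = 0" for j
    by (cases "j \<le> r") auto
  then show ?thesis
    by (simp add: d_def wt_def fun_eq_iff)
qed

text \<open>Adding \<open>\<alpha>\<^sub>j\<close> changes only the summands \<open>j - 1\<close>
  and \<open>j\<close> of \<open>vq\<close>. The sum of their exponents is governed by
  \<open>tau\<close> and their difference by the pairing with \<open>\<alpha>\<^sub>j\<close>, so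
  that the two contributions combine into \<open>T * (A - inverse A)\<close>.\<close>

lemma vq_step:
  fixes \<Lambda> :: "nat \<Rightarrow> complex" and \<beta> :: "nat \<Rightarrow> nat"
  assumes j: "j \<in> {1..r}" and q: "exp h = q" "q ^ 2 \<noteq> 1"
  defines "a \<equiv> wform r (\<Lambda> - wt \<beta>) (wt (sroot j))"
  shows "vq r q h \<Lambda> (\<beta> + sroot j) = vq r q h \<Lambda> \<beta> +
    qpow h (- tau r \<Lambda> j (\<beta> + sroot j)) * ((qpow h a - inverse (qpow h a)) / (q - inverse q))"
proof -
  define y where "y = \<Lambda> + rho r - wt \<beta>"
  define y' where "y' = y - wt (sroot j)"
  define X where "X = (\<lambda>i. wform r y (fweight r i - fweight r (i + 1)))"
  define X' where "X' = (\<lambda>i. wform r y' (fweight r i - fweight r (i + 1)))"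
  have q0: "q \<noteq> 0"
    using q by auto
  have dq: "q - inverse q \<noteq> 0"
    using q q0 by (auto simp: field_simps power2_eq_square)
  \<comment> \<open>Multiplying out merges the second power into a shift of the weight by
    \<open>- wt \<gamma>\<close>. The first powers no longer depend on \<open>\<gamma>\<close> and
    cancel in the difference below.\<close>
  have vq: "vq r q h \<Lambda> \<gamma> = 1 / (q - inverse q) ^ 2 * (\<Sum>i=0..r.
      qpow h (2 * wform r (\<Lambda> + rho r) (fweight r i - fweight r (i + 1))) -
      qpow h (2 * wform r (\<Lambda> + rho r - wt \<gamma>) (fweight r i - fweight r (i + 1))))" for \<gamma>
    unfolding vq_def
    by (intro arg_cong2[where f = "(*)"] refl sum.cong)
       (simp add: algebra_simps wform_diff_left wform_diff_right flip: qpow_add)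
  have y': "\<Lambda> + rho r - wt (\<beta> + sroot j) = y'"
    by (simp add: y'_def y_def wt_add)
  have XX: "X' i = X i - ((if i = j then 1 else 0) - (if i + 1 = j then 1 else 0))" if "i \<le> r" for i
    using that j by (simp add: X_def X'_def y'_def wform_diff_left wform_diff_right sroot_fweight)
  have "(q - inverse q)^2 * (vq r q h \<Lambda> (\<beta> + sroot j) - vq r q h \<Lambda> \<beta>) =
      (\<Sum>i=0..r. qpow h (2 * X i) - qpow h (2 * X' i))"
  proof -
    have "(q - inverse q)^2 * (1 / (q - inverse q)^2 * S - 1 / (q - inverse q)^2 * S') = S - S'"
      for S S'
      using dq by (simp add: right_diff_distrib)
    then show ?thesis
      unfolding vq y' by (simp add: X_def X'_def y_def flip: sum_subtractf)
  qed
  also have "\<dots> = (\<Sum>i\<in>{j - 1, j}. qpow h (2 * X i) - qpow h (2 * X' i))"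
    using j by (intro sum.mono_neutral_right) (auto simp: XX)
  also have "\<dots> = (qpow h (2 * X (j - 1)) - qpow h (2 * X (j - 1) + 2))
      + (qpow h (2 * X j) - qpow h (2 * X j - 2))"
  proof -
    have "X' (j - 1) = X (j - 1) + 1" "X' j = X j - 1"
      using j by (auto simp: XX)
    moreover have "j - 1 \<noteq> j"
      using j by auto
    ultimately show ?thesis
      by (simp add: distrib_left right_diff_distrib)
  qed
  also have "\<dots> = qpow h (2 * X (j - 1)) * (1 - q ^ 2) + qpow h (2 * X j) * (1 - inverse q ^ 2)"
  proof -
    have "qpow h 2 = q ^ 2"
      using qpow_power[of h 1 2] q by (simp add: qpow_1)
    then show ?thesis
      by (simp add: qpow_add qpow_diff right_diff_distrib divide_inverse power_inverse)
  qed
  finally have D: "(q - inverse q)^2 * (vq r q h \<Lambda> (\<beta> + sroot j) - vq r q h \<Lambda> \<beta>) =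
      qpow h (2 * X (j - 1)) * (1 - q ^ 2) + qpow h (2 * X j) * (1 - inverse q ^ 2)" .
  define t where "t = tau r \<Lambda> j (\<beta> + sroot j)"
  \<comment> \<open>\<open>\<alpha>\<^sub>j\<close> is orthogonal to both neighbouring fundamental
    weights, so \<open>tau\<close> may be evaluated at \<open>y\<close> as well as at
    \<open>y'\<close>.\<close>
  have "t = wform r y (fweight r (j + 1) - fweight r (j - 1))"
  proof -
    have "wform r (wt (sroot j)) (fweight r (j + 1)) = 0"
      "wform r (wt (sroot j)) (fweight r (j - 1)) = 0"
      using j by (auto simp: sroot_fweight)
    then show ?thesis
      unfolding t_def tau_def y' y'_def by (simp add: wform_diff_left[of r y] wform_diff_right)
  qed
  then have t: "X (j - 1) + X j = - t"
    using j by (simp add: X_def wform_diff_right)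
  \<comment> \<open>The shift by 1 is the pairing of \<open>rho r\<close> with
    \<open>\<alpha>\<^sub>j\<close>.\<close>
  have "a + 1 = wform r y (wt (sroot j))"
    using j by (simp add: a_def y_def wform_diff_left wform_add_left rho_sroot)
  then have a: "X j - X (j - 1) = a + 1"
    using j by (simp add: wform_sroot_fweight X_def wform_diff_right)
  have e1: "2 * X (j - 1) = - t - (a + 1)" and e2: "2 * X j = - t + (a + 1)"
    by (simp_all flip: t a)
  define A where "A = qpow h a"
  define T where "T = qpow h (- t)"
  have [simp]: "A \<noteq> 0"
    by (simp add: A_def)
  have "(q - inverse q)^2 * (vq r q h \<Lambda> (\<beta> + sroot j) - vq r q h \<Lambda> \<beta>) =
      T / (A * q) * (1 - q ^ 2) + T * (A * q) * (1 - inverse q ^ 2)"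
    unfolding D e1 e2 by (simp only: qpow_add qpow_diff qpow_1 q A_def T_def)
  also have "\<dots> = T * (A - inverse A) * (q - inverse q)"
  proof -
    have "T / (A * q) * (1 - q ^ 2) = T * inverse A * (inverse q - q)"
      using q0 by (simp add: right_diff_distrib power2_eq_square divide_inverse)
    moreover have "T * (A * q) * (1 - inverse q ^ 2) = T * A * (q - inverse q)"
      using q0 by (simp add: right_diff_distrib power2_eq_square)
    ultimately show ?thesis
      by (simp add: algebra_simps)
  qed
  finally have "vq r q h \<Lambda> (\<beta> + sroot j) - vq r q h \<Lambda> \<beta>
      = T * (A - inverse A) * (q - inverse q) / (q - inverse q)^2"
    using dq by (simp add: eq_divide_eq mult.commute)
  also have "\<dots> = T * ((A - inverse A) / (q - inverse q))"
    using dq by (simp add: power2_eq_square)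
  finally show ?thesis
    by (simp add: A_def T_def t_def algebra_simps)
qed

lemma vq_zero [simp]: "vq r q h \<Lambda> 0 = 0"
  by (simp add: vq_def)

section \<open>Modules and singular vectors\<close>

text \<open>An update at a fresh key is the addition of a \<open>single\<close>. On the free algebra
  this reduces a claim closed under addition to scalar multiples of words.\<close>

lemma poly_mapping_induct [case_names single sum]:
  fixes x :: "'a \<Rightarrow>\<^sub>0 'b::monoid_add"
  assumes single: "\<And>k c. P (Poly_Mapping.single k c)"
    and sum: "\<And>x y. P x \<Longrightarrow> P y \<Longrightarrow> P (x + y)"
  shows "P x"
proof (induction x rule: update_induct)
  case const
  show ?case
    using single[of undefined 0] by simp
next
  case (update f a b)
  have "Poly_Mapping.update a b f = Poly_Mapping.single a b + f"
    using update(1)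
    by (intro poly_mapping_eqI) (auto simp: lookup_update lookup_add lookup_single in_keys_iff when_def)
  with update(3) show ?case
    using sum single by simp
qed

section \<open>The action of the generators on a module\<close>

locale uq_mod =
  fixes r :: nat and q h :: complex and \<Lambda> :: "nat \<Rightarrow> complex"
    and scale :: "complex \<Rightarrow> 'v::ab_group_add \<Rightarrow> 'v"
    and act :: "freealg \<Rightarrow> 'v \<Rightarrow> 'v"
  assumes uq_module: "uq_module r q scale act"
    and exp_h: "exp h = q"
    and not_root_of_unity: "\<And>n. n > 0 \<Longrightarrow> q ^ n \<noteq> 1"

sublocale uq_mod \<subseteq> vector_space scale
  using uq_module by (simp add: uq_module_def)

context uq_mod
begin

lemma act_const: "act (const c) v = scale c v"
  and act_mult: "act (x * y) v = act x (act y v)"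
  and act_add_left: "act (x + y) v = act x v + act y v"
  and act_add: "act x (u + v) = act x u + act x v"
  and act_rel: "x \<in> uq_rels r q \<Longrightarrow> act x v = 0"
  using uq_module by (simp_all add: uq_module_def)

lemma act_zero [simp]: "act x 0 = 0"
  using act_add[of x 0 0] by simp

lemma act_diff_left: "act (x - y) v = act x v - act y v"
  using act_add_left[of "x - y" y v] by simp

lemma act_one [simp]: "act 1 v = v"
  using act_const[of 1 v] by (simp add: const_def)

text \<open>Compatibility of \<open>act x\<close> with scalars is not among the module axioms; it
  follows because constants act by \<open>scale\<close> and are central in the free algebra.\<close>

lemma act_scale: "act x (scale c v) = scale c (act x v)"
proof -
  have "x * const c = const c * x"
    unfolding const_def
  proof (induction x rule: poly_mapping_induct)
    case (single k a)
    then show ?case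
      by (simp add: mult_single mult.commute)
  qed (simp add: ring_distribs)
  then show ?thesis
    by (metis act_const act_mult)
qed

lemma act_diff: "act x (u - v) = act x u - act x v"
  using act_add[of x "u - v" v] by simp

lemma act_sum: "act x (\<Sum>a\<in>A. f a) = (\<Sum>a\<in>A. act x (f a))"
  by (induction A rule: infinite_finite_induct) (auto simp: act_add)

lemma act_unused: "i \<notin> {1..r} \<Longrightarrow> g \<in> {GE i, GF i, GK i, GKinv i} \<Longrightarrow> act (gen g) v = 0"
  by (rule act_rel) (rule uq_rels.unused)

lemma act_Kinv_K: "i \<in> {1..r} \<Longrightarrow> act (Kig i) (act (Kg i) v) = v"
  using act_rel[OF uq_rels.KinvK, of i v] by (simp add: act_diff_left act_mult)

lemma act_K_F:
  "i \<in> {1..r} \<Longrightarrow> j \<in> {1..r} \<Longrightarrow>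
    act (Kg i) (act (Fg j) v) = scale (q powi (- cartan j i)) (act (Fg j) (act (Kg i) v))"
  using act_rel[OF uq_rels.KF, of i j v] by (simp add: act_diff_left act_mult act_const)

lemma act_E_F:
  "i \<in> {1..r} \<Longrightarrow> j \<in> {1..r} \<Longrightarrow> act (Eg i) (act (Fg j) v) = act (Fg j) (act (Eg i) v) +
    (if i = j then scale (1 / (q - inverse q)) (act (Kg i) v - act (Kig i) v) else 0)"
  using act_rel[OF uq_rels.EF, of i j v]
  by (cases "i = j") (simp_all add: act_diff_left act_mult act_const diff_eq_eq add.commute)

lemma act_invariant:
  assumes W: "subspace W" and g: "\<And>g v. v \<in> W \<Longrightarrow> act (gen g) v \<in> W"
  shows "v \<in> W \<Longrightarrow> act x v \<in> W"
proof (induction x arbitrary: v rule: poly_mapping_induct)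
  case (single k c)
  obtain l where k: "k = Free_Mon l"
    by (cases k)
  have "act (Poly_Mapping.single (Free_Mon l) c) v \<in> W" if "v \<in> W" for v
    using that
  \<comment> \<open>The last letter of a word acts first, so words are peeled from the right and the
    induction hypothesis is used at \<open>act (gen g) v\<close>.\<close>
  proof (induction l arbitrary: v rule: rev_induct)
    case Nil
    then show ?case
      using act_const[of c v] W by (simp add: const_def zero_free_mon_def subspace_scale)
  next
    case (snoc g l)
    have "Poly_Mapping.single (Free_Mon (l @ [g])) c =
        Poly_Mapping.single (Free_Mon l) c * gen g"
      by (simp add: gen_def mult_single plus_free_mon_def)
    with snoc show ?case
      by (simp add: act_mult g)
  qed
  with k single show ?case
    by simp
next
  case (sum x y)
  then show ?case
    using W by (simp add: act_add_left subspace_add)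
qed

section \<open>Weight spaces and the eigenvalues \<open>chi\<close> of the \<open>K\<^sub>i\<close>
  on them\<close>

definition chi :: "(nat \<Rightarrow> nat) \<Rightarrow> nat \<Rightarrow> complex" where
  "chi \<beta> i = qpow h (wform r (\<Lambda> - wt \<beta>) (wt (sroot i)))"

lemma chi_nonzero [simp]: "chi \<beta> i \<noteq> 0"
  by (simp add: chi_def)

lemma chi_add_sroot:
  assumes "i \<in> {1..r}" "j \<in> {1..r}"
  shows "chi (\<beta> + sroot j) i = chi \<beta> i * q powi (- cartan j i)"
proof -
  have "chi (\<beta> + sroot j) i = qpow h (wform r (\<Lambda> - wt \<beta>) (wt (sroot i)) + of_int (- cartan j i))"
    using assms by (simp add: chi_def wt_add wform_diff_left wform_add_left wform_sroot_sroot
        diff_diff_eq)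
  then show ?thesis
    by (simp only: qpow_add qpow_of_int exp_h chi_def)
qed

text \<open>The contribution of \<open>\<Lambda>\<close> cancels in the quotient of two eigenvalues,
  leaving an integer power of \<open>q\<close>. As \<open>q\<close> is not a root of unity, the
  exponent is 0, and nondegeneracy of the Cartan matrix applies.\<close>

lemma chi_inject:
  assumes "\<beta> \<in> Qplus r" "\<gamma> \<in> Qplus r" "\<And>i. i \<in> {1..r} \<Longrightarrow> chi \<beta> i = chi \<gamma> i"
  shows "\<beta> = \<gamma>"
proof (rule Qplus_eqI_cartan[OF assms(1,2)])
  fix i assume i: "i \<in> {1..r}"
  define n where "n = (\<Sum>j=1..r. (int (\<beta> j) - int (\<gamma> j)) * cartan j i)"
  have n: "of_int n = wform r (wt \<beta>) (wt (sroot i)) - wform r (wt \<gamma>) (wt (sroot i))"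
    unfolding wform_sroot[OF i] n_def
    by (simp add: wt_def left_diff_distrib sum_subtractf)
  have "qpow h (of_int n) = chi \<gamma> i / chi \<beta> i"
    by (simp add: n chi_def wform_diff_left flip: qpow_diff)
  also have "\<dots> = 1"
    using assms(3)[OF i] by simp
  finally have q1: "q powi n = 1"
    by (simp add: qpow_of_int exp_h)
  have "q ^ nat \<bar>n\<bar> = 1"
  proof (cases "n \<ge> 0")
    case True
    with q1 show ?thesis
      by (simp add: power_int_def)
  next
    case False
    with q1 have "inverse q ^ nat (- n) = 1"
      by (simp add: power_int_def)
    with False show ?thesis
      by (simp add: power_inverse)
  qed
  with not_root_of_unity[of "nat \<bar>n\<bar>"] have "n = 0"
    by (cases "n = 0") auto
  with n show "wform r (wt \<beta>) (wt (sroot i)) = wform r (wt \<gamma>) (wt (sroot i))"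
    by simp
qed

definition wspace :: "(nat \<Rightarrow> nat) \<Rightarrow> 'v set" where
  "wspace \<beta> = {v. \<forall>i\<in>{1..r}. act (Kg i) v = scale (chi \<beta> i) v}"

lemma weight_space_eq: "weight_space r h scale act (\<Lambda> - wt \<beta>) = wspace \<beta>"
  by (simp add: weight_space_def wspace_def chi_def)

lemma subspace_wspace: "subspace (wspace \<beta>)"
  by (auto simp: subspace_def wspace_def act_add act_scale scale_right_distrib scale_left_commute)

lemma act_K: "v \<in> wspace \<beta> \<Longrightarrow> i \<in> {1..r} \<Longrightarrow> act (Kg i) v = scale (chi \<beta> i) v"
  by (simp add: wspace_def)

lemma act_K_pow: "v \<in> wspace \<beta> \<Longrightarrow> i \<in> {1..r} \<Longrightarrow> act (Kg i ^ n) v = scale (chi \<beta> i ^ n) v"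
  by (induction n) (simp_all add: act_mult act_K act_scale mult.commute)

lemma act_Kinv:
  assumes "v \<in> wspace \<beta>" "i \<in> {1..r}"
  shows "act (Kig i) v = scale (inverse (chi \<beta> i)) v"
proof -
  have "scale (inverse (chi \<beta> i)) v = scale (inverse (chi \<beta> i)) (act (Kig i) (act (Kg i) v))"
    using assms by (simp add: act_Kinv_K)
  also have "\<dots> = act (Kig i) v"
    using assms by (simp only: act_K act_scale scale_scale) simp
  finally show ?thesis ..
qed

lemma act_F_wspace:
  assumes "v \<in> wspace \<beta>" "j \<in> {1..r}"
  shows "act (Fg j) v \<in> wspace (\<beta> + sroot j)"
  unfolding wspace_def using assms
  by (auto simp: act_K_F act_K act_scale chi_add_sroot mult.commute)

lemma act_Fbar:
  assumes "v \<in> wspace \<beta>" "j \<in> {1..r}"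
  shows "act (Fbar j) v = scale (chi \<beta> j ^ (j - 1)) (act (Fg j) v)"
  using assms by (simp add: Fbar_def act_mult act_K_pow act_scale)

lemma act_E_F_wspace:
  assumes "v \<in> wspace \<beta>" "i \<in> {1..r}" "j \<in> {1..r}"
  shows "act (Eg i) (act (Fg j) v) = act (Fg j) (act (Eg i) v) +
    (if i = j then scale ((chi \<beta> i - inverse (chi \<beta> i)) / (q - inverse q)) v else 0)"
  using assms by (simp add: act_E_F act_K act_Kinv flip: scale_left_diff_distrib)

text \<open>Eigenvectors are eliminated as usual: \<open>K\<^sub>i\<close> minus its eigenvalue on
  \<open>wspace \<beta>\<close> removes the component at \<open>\<beta>\<close> and rescales the
  others. The index \<open>i\<close> is chosen for each \<open>\<gamma>\<close> so that the
  component at \<open>\<gamma>\<close> survives.\<close>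

lemma wspace_independent:
  assumes "finite A" "A \<subseteq> Qplus r" "\<And>\<gamma>. \<gamma> \<in> A \<Longrightarrow> v \<gamma> \<in> wspace \<gamma>" "(\<Sum>\<gamma>\<in>A. v \<gamma>) = 0"
    and "\<gamma> \<in> A"
  shows "v \<gamma> = 0"
  using assms
proof (induction A arbitrary: v \<gamma> rule: finite_induct)
  case (insert \<beta> A)
  have zero: "v \<gamma> = 0" if \<gamma>: "\<gamma> \<in> A" for \<gamma>
  proof -
    obtain i where i: "i \<in> {1..r}" "chi \<gamma> i \<noteq> chi \<beta> i"
      using chi_inject[of \<gamma> \<beta>] \<gamma> insert by blast
    define u where "u = (\<lambda>\<delta>. scale (chi \<delta> i - chi \<beta> i) (v \<delta>))"
    have u: "u \<delta> = act (Kg i) (v \<delta>) - scale (chi \<beta> i) (v \<delta>)" if "\<delta> \<in> insert \<beta> A" for \<delta>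
      using insert.prems(2)[OF that] i by (simp add: u_def act_K scale_left_diff_distrib)
    have "(\<Sum>\<delta>\<in>insert \<beta> A. u \<delta>) = 0"
      using insert.prems(3)
      by (simp add: u sum_subtractf del: sum.insert flip: act_sum scale_sum_right)
    moreover have "u \<beta> = 0"
      by (simp add: u_def)
    ultimately have "(\<Sum>\<delta>\<in>A. u \<delta>) = 0"
      using insert.hyps by simp
    moreover have "u \<delta> \<in> wspace \<delta>" if "\<delta> \<in> A" for \<delta>
      unfolding u_def using insert.prems(2) that by (intro subspace_scale[OF subspace_wspace]) auto
    ultimately have "u \<gamma> = 0"
      using insert.IH[of u \<gamma>] insert.prems(1) \<gamma> by auto
    with i show ?thesis
      by (simp add: u_def)
  qed
  moreover from zero have "v \<beta> = 0"
    using insert.prems(3) insert.hyps by simp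
  ultimately show ?case
    using insert.prems(4) by auto
qed simp

section \<open>Words in the \<open>F\<^sub>i\<close> and the submodules they span\<close>

text \<open>\<open>\<delta>\<close> is the depth of the starting vector \<open>u \<in> V[\<Lambda> - \<delta>]\<close>, so that \<open>\<gamma>\<close> is the depth of the word
  applied to \<open>u\<close>.\<close>

inductive fword :: "'v \<Rightarrow> (nat \<Rightarrow> nat) \<Rightarrow> (nat \<Rightarrow> nat) \<Rightarrow> 'v \<Rightarrow> bool" for u \<delta> where
  base: "fword u \<delta> \<delta> u"
| step: "fword u \<delta> \<gamma> v \<Longrightarrow> i \<in> {1..r} \<Longrightarrow> fword u \<delta> (\<gamma> + sroot i) (act (Fg i) v)"

lemma fword_wspace: "fword u \<delta> \<gamma> v \<Longrightarrow> u \<in> wspace \<delta> \<Longrightarrow> v \<in> wspace \<gamma>"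
  by (induction rule: fword.induct) (simp_all add: act_F_wspace)

lemma fword_Qplus: "fword u \<delta> \<gamma> v \<Longrightarrow> \<delta> \<in> Qplus r \<Longrightarrow> \<gamma> \<in> Qplus r"
  by (induction rule: fword.induct) (simp_all add: Qplus_add_sroot)

lemma fword_le: "fword u \<delta> \<gamma> v \<Longrightarrow> \<delta> \<le> \<gamma>"
  by (induction rule: fword.induct) (auto simp: le_fun_def intro: trans_le_add1)

text \<open>Every letter strictly increases the depth, so only the empty word stays at the depth of
  \<open>u\<close>.\<close>

lemma fword_same: "fword u \<delta> \<gamma> v \<Longrightarrow> \<gamma> = \<delta> \<Longrightarrow> v = u"
proof (induction rule: fword.cases)
  case (step \<gamma>' v' i)
  then have "\<delta> \<le> \<gamma>'"
    using fword_le by blast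
  then have "\<delta> i \<le> \<gamma>' i"
    by (simp add: le_fun_def)
  moreover have "\<delta> i = Suc (\<gamma>' i)"
    using step by (simp add: sroot_def)
  ultimately show ?case
    by simp
qed

lemma act_span:
  assumes "v \<in> span S" "subspace W" "\<And>v. v \<in> S \<Longrightarrow> act x v \<in> W"
  shows "act x v \<in> W"
  using assms(1)
  by (induction rule: span_induct_alt)
    (use assms in \<open>auto simp: act_add act_scale intro: subspace_0 subspace_add subspace_scale\<close>)

text \<open>If \<open>u\<close> is a weight vector killed by all \<open>E\<^sub>i\<close>, this is
  the submodule generated by \<open>u\<close>, by \<open>fspan_invariant\<close>.\<close>

definition fspan :: "'v \<Rightarrow> (nat \<Rightarrow> nat) \<Rightarrow> 'v set" where
  "fspan u \<delta> = span {v. \<exists>\<gamma>. fword u \<delta> \<gamma> v}"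

text \<open>Words are grouped by depth. The components \<open>f\<close> are defined on all depths
  and vanish off \<open>A\<close>, so that the sum can be taken over any larger finite set.\<close>

lemma fspan_decompose:
  assumes "v \<in> fspan u \<delta>" "\<delta> \<in> Qplus r"
  obtains A f where "finite A" "A \<subseteq> Qplus r" "\<And>\<gamma>. f \<gamma> \<in> span {v. fword u \<delta> \<gamma> v}"
    "\<And>\<gamma>. \<gamma> \<notin> A \<Longrightarrow> f \<gamma> = 0" "v = (\<Sum>\<gamma>\<in>A. f \<gamma>)"
proof -
  have "\<exists>A f. finite A \<and> A \<subseteq> Qplus r \<and> (\<forall>\<gamma>. f \<gamma> \<in> span {v. fword u \<delta> \<gamma> v}) \<and>
    (\<forall>\<gamma>. \<gamma> \<notin> A \<longrightarrow> f \<gamma> = 0) \<and> v = (\<Sum>\<gamma>\<in>A. f \<gamma>)"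
    using assms(1) unfolding fspan_def
  proof (induction rule: span_induct_alt)
    case base
    show ?case
      by (rule exI[of _ "{}"], rule exI[of _ "\<lambda>_. 0"]) (simp add: span_zero)
  next
    case (step c x y)
    then obtain A f \<beta> where A: "finite A" "A \<subseteq> Qplus r" "\<And>\<gamma>. f \<gamma> \<in> span {v. fword u \<delta> \<gamma> v}"
      "\<And>\<gamma>. \<gamma> \<notin> A \<Longrightarrow> f \<gamma> = 0" "y = (\<Sum>\<gamma>\<in>A. f \<gamma>)" and \<beta>: "fword u \<delta> \<beta> x"
      by auto
    define g where "g = (\<lambda>\<gamma>. (if \<gamma> = \<beta> then scale c x else 0) + f \<gamma>)"
    have "(\<Sum>\<gamma>\<in>insert \<beta> A. f \<gamma>) = (\<Sum>\<gamma>\<in>A. f \<gamma>)"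
      using A by (intro sum.mono_neutral_right) auto
    then have "scale c x + y = (\<Sum>\<gamma>\<in>insert \<beta> A. g \<gamma>)"
      using A(1) unfolding g_def A(5) sum.distrib by simp
    moreover have "x \<in> span {v. fword u \<delta> \<beta> v}"
      using \<beta> by (intro span_base) simp
    then have "g \<gamma> \<in> span {v. fword u \<delta> \<gamma> v}" for \<gamma>
      unfolding g_def using A(3)[of \<gamma>] by (auto intro: span_add span_scale)
    moreover have "\<beta> \<in> Qplus r"
      using fword_Qplus[OF \<beta> assms(2)] .
    ultimately show ?case
      using A(1,2,4)
      by (intro exI[of _ "insert \<beta> A"] exI[of _ g]) (auto simp: g_def)
  qed
  with that show ?thesis
    by blast
qed

text \<open>Both \<open>v\<close> and the components of its decomposition are weight vectors, so by
  independence of weight spaces \<open>v\<close> equals its own component at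
  \<open>\<beta>\<close>.\<close>

lemma fspan_wspace:
  assumes v: "v \<in> fspan u \<delta>" "v \<in> wspace \<beta>" and u: "u \<in> wspace \<delta>"
    and \<delta>: "\<delta> \<in> Qplus r" and \<beta>: "\<beta> \<in> Qplus r"
  shows "v \<in> span {v. fword u \<delta> \<beta> v}"
proof -
  obtain A f where A: "finite A" "A \<subseteq> Qplus r" "\<And>\<gamma>. f \<gamma> \<in> span {v. fword u \<delta> \<gamma> v}"
    "\<And>\<gamma>. \<gamma> \<notin> A \<Longrightarrow> f \<gamma> = 0" "v = (\<Sum>\<gamma>\<in>A. f \<gamma>)"
    using fspan_decompose[OF v(1) \<delta>] by metis
  \<comment> \<open>The components of \<open>v - v\<close>, with one copy decomposed and the other
    placed entirely at \<open>\<beta>\<close>.\<close>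
  define g where "g = (\<lambda>\<gamma>. f \<gamma> - (if \<gamma> = \<beta> then v else 0))"
  have "(\<Sum>\<gamma>\<in>insert \<beta> A. f \<gamma>) = (\<Sum>\<gamma>\<in>A. f \<gamma>)"
    using A by (intro sum.mono_neutral_right) auto
  then have "(\<Sum>\<gamma>\<in>insert \<beta> A. g \<gamma>) = 0"
    using A(1,5) by (simp add: g_def sum_subtractf)
  moreover have "span {v. fword u \<delta> \<gamma> v} \<subseteq> wspace \<gamma>" for \<gamma>
    using u by (intro span_minimal subspace_wspace) (auto intro: fword_wspace)
  then have "g \<gamma> \<in> wspace \<gamma>" for \<gamma>
    unfolding g_def using A(3)[of \<gamma>] v(2)
    by (auto intro!: subspace_diff[OF subspace_wspace])
  ultimately have "g \<beta> = 0"
    using A(1,2) \<beta> by (intro wspace_independent[of "insert \<beta> A" g]) auto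
  with A(3)[of \<beta>] show ?thesis
    by (simp add: g_def)
qed

text \<open>Equal \<open>i\<close>-coordinates mean that the word contains no
  \<open>F\<^sub>i\<close>; then \<open>E\<^sub>i\<close> commutes with all its letters and reaches
  \<open>u\<close>.\<close>

lemma fword_E_vanish:
  assumes "fword u \<delta> \<gamma> v" "u \<in> wspace \<delta>" "act (Eg i) u = 0" "i \<in> {1..r}" "\<gamma> i = \<delta> i"
  shows "act (Eg i) v = 0"
  using assms
proof (induction rule: fword.induct)
  case (step \<gamma> v j)
  have "\<delta> i \<le> \<gamma> i"
    using fword_le[OF step.hyps(1)] by (simp add: le_fun_def)
  with step.prems have "i \<noteq> j" "\<gamma> i = \<delta> i"
    by (auto simp: sroot_def split: if_splits)
  with step show ?case
    by (simp add: act_E_F)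
qed

text \<open>\<open>F\<^sub>i\<close> lengthens words and \<open>K\<^sub>i\<close> rescales them.
  \<open>E\<^sub>i\<close> is moved to the right until it kills \<open>u\<close>; each commutator on
  the way is a scalar on a shorter word, since that word is a weight vector.\<close>

lemma fspan_invariant:
  assumes u: "u \<in> wspace \<delta>" "\<And>i. i \<in> {1..r} \<Longrightarrow> act (Eg i) u = 0" and v: "v \<in> fspan u \<delta>"
  shows "act x v \<in> fspan u \<delta>"
proof (rule act_invariant[OF _ _ v])
  show sub: "subspace (fspan u \<delta>)"
    by (simp add: fspan_def)
  fix g v assume v: "v \<in> fspan u \<delta>"
  have word: "act (gen g) v \<in> fspan u \<delta>" if v: "fword u \<delta> \<gamma> v" for \<gamma> v
  proof -
    have base: "v \<in> fspan u \<delta>"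
      unfolding fspan_def using v by (intro span_base) blast
    have w: "v \<in> wspace \<gamma>"
      using fword_wspace[OF v u(1)] .
    obtain i where g: "g \<in> {GE i, GF i, GK i, GKinv i}"
      by (cases g) auto
    show ?thesis
    proof (cases "i \<in> {1..r}")
      case False
      with g show ?thesis
        by (simp only: act_unused subspace_0[OF sub])
    next
      case i: True
      have F: "act (Fg j) v \<in> fspan u \<delta>" if "v \<in> fspan u \<delta>" "j \<in> {1..r}" for v j
      proof (rule act_span[OF that(1)[unfolded fspan_def] sub])
        show "act (Fg j) v \<in> fspan u \<delta>" if "v \<in> {v. \<exists>\<gamma>. fword u \<delta> \<gamma> v}" for v
          unfolding fspan_def using that fword.step[OF _ \<open>j \<in> {1..r}\<close>]
          by (intro span_base CollectI) blast
      qed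
      have "act (Eg i) v \<in> fspan u \<delta>"
        using v
      proof (induction rule: fword.induct)
        case base
        then show ?case
          using u(2)[OF i] by (simp add: subspace_0[OF sub])
      next
        case (step \<gamma> v j)
        have v: "v \<in> fspan u \<delta>"
          unfolding fspan_def using step(1) by (intro span_base) blast
        have "act (Fg j) (act (Eg i) v) \<in> fspan u \<delta>"
          using F step by blast
        with v step i fword_wspace[OF step(1) u(1)] show ?case
          by (auto simp: act_E_F_wspace intro!: subspace_add[OF sub] subspace_scale[OF sub])
      qed
      with g w i base F[OF base i] show ?thesis
        by (auto simp: act_K act_Kinv intro!: subspace_scale[OF sub])
    qed
  qed
  show "act (gen g) v \<in> fspan u \<delta>"
    by (rule act_span[OF v[unfolded fspan_def] sub]) (use word in blast)
qed

lemma singular_vector_generates: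
  assumes "irreducible_module scale act" "u \<noteq> 0"
    and "u \<in> wspace \<delta>" "\<And>i. i \<in> {1..r} \<Longrightarrow> act (Eg i) u = 0"
  shows "fspan u \<delta> = UNIV"
proof -
  have "u \<in> fspan u \<delta>"
    unfolding fspan_def by (intro span_base) (auto intro: fword.base)
  moreover have "fspan u \<delta> = {0} \<or> fspan u \<delta> = UNIV"
    using assms fspan_invariant[OF assms(3,4)]
    unfolding irreducible_module_def by (auto simp: fspan_def)
  ultimately show ?thesis
    using assms(2) by auto
qed

end

section \<open>Path vectors\<close>

lemma paths_zero: "paths r 0 = {[0]}"
proof (intro equalityI subsetI)
  fix p assume p: "p \<in> paths r 0"
  then have "p \<noteq> []" "hd p = 0" "last p = 0"
    by (auto simp: paths_def)
  \<comment> \<open>The coordinates of the \<open>k\<close>-th vertex add up to \<open>k\<close>, so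
    a path ending at 0 has one vertex.\<close>
  with path_nth(2)[OF p, of "length p - 1"] have "length p = 1"
    by (cases p) (auto simp: last_conv_nth split: if_splits)
  with \<open>hd p = 0\<close> show "p \<in> {[0]}"
    by (cases p) auto
qed (simp add: paths_def)

lemma paths_step:
  assumes p: "p \<in> paths r \<beta>" and i: "i \<in> {1..r}"
  shows "p @ [\<beta> + sroot i] \<in> paths r (\<beta> + sroot i)"
proof -
  have "\<beta> \<in> Qplus r"
    using p last_in_set[of p] by (auto simp: paths_def)
  moreover have "\<exists>j\<in>{1..r}. (p @ [\<beta> + sroot i]) ! k = (p @ [\<beta> + sroot i]) ! (k - 1) + sroot j"
    if k: "1 \<le> k" "k < Suc (length p)" for k
  proof (cases "k = length p")
    case True
    with k p have "(p @ [\<beta> + sroot i]) ! (k - 1) = \<beta>"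
      by (auto simp: nth_append paths_def last_conv_nth)
    with True i show ?thesis
      by (auto simp: nth_append)
  next
    case False
    with k p show ?thesis
      by (auto simp: nth_append paths_def)
  qed
  ultimately show ?thesis
    using p i by (auto simp: paths_def Qplus_add_sroot)
qed

lemma paths_last_step:
  assumes p: "p \<in> paths r \<beta>" and "\<beta> \<noteq> 0"
  obtains p' i where "p = p' @ [\<beta>]" "i \<in> {1..r}" "\<beta> i > 0" "p' \<in> paths r (\<beta> - sroot i)"
proof -
  define p' where "p' = butlast p"
  have pp: "p = p' @ [\<beta>]"
    using p by (auto simp: p'_def paths_def)
  have step: "\<exists>i\<in>{1..r}. p ! k = p ! (k - 1) + sroot i" if "1 \<le> k" "k < length p" for k
    using p that by (auto simp: paths_def)
  have "p' \<noteq> []"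
  proof
    assume "p' = []"
    then have "\<beta> = 0"
      using p by (simp add: pp paths_def)
    with \<open>\<beta> \<noteq> 0\<close> show False ..
  qed
  with step[of "length p'"] have "\<exists>i\<in>{1..r}. \<beta> = last p' + sroot i"
    by (simp add: pp nth_append last_conv_nth Suc_le_eq)
  then obtain i where i: "i \<in> {1..r}" "\<beta> = last p' + sroot i"
    by blast
  have "\<exists>i\<in>{1..r}. p' ! k = p' ! (k - 1) + sroot i" if k: "1 \<le> k" "k < length p'" for k
  proof -
    have "k - 1 < length p'"
      using k by simp
    with step[of k] k show ?thesis
      by (simp add: pp nth_append)
  qed
  then have "p' \<in> paths r (last p')"
    using p \<open>p' \<noteq> []\<close> by (simp add: paths_def pp)
  moreover have "\<beta> i > 0" "\<beta> - sroot i = last p'"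
    by (simp_all add: i(2) sroot_def fun_eq_iff)
  ultimately show ?thesis
    using that pp i(1) by metis
qed

lemma paths_eq_UN:
  assumes "\<beta> \<noteq> 0"
  shows "paths r \<beta> = (\<Union>i\<in>{i\<in>{1..r}. \<beta> i > 0}. (\<lambda>p. p @ [\<beta>]) ` paths r (\<beta> - sroot i))"
proof (intro equalityI subsetI)
  fix p assume "p \<in> paths r \<beta>"
  from paths_last_step[OF this assms]
  show "p \<in> (\<Union>i\<in>{i\<in>{1..r}. \<beta> i > 0}. (\<lambda>p. p @ [\<beta>]) ` paths r (\<beta> - sroot i))"
    by blast
next
  fix p assume "p \<in> (\<Union>i\<in>{i\<in>{1..r}. \<beta> i > 0}. (\<lambda>p. p @ [\<beta>]) ` paths r (\<beta> - sroot i))"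
  then obtain i p' where "i \<in> {1..r}" "\<beta> i > 0" "p' \<in> paths r (\<beta> - sroot i)" "p = p' @ [\<beta>]"
    by blast
  with paths_step[of p' r "\<beta> - sroot i" i] show "p \<in> paths r \<beta>"
    by (simp add: minus_sroot_add)
qed

text \<open>The families for different \<open>i\<close> are disjoint because the last vertex of the
  shortened path determines \<open>i\<close>. The condition \<open>\<beta> i > 0\<close> keeps the
  truncated subtraction exact.\<close>

lemma sum_paths:
  fixes f :: "(nat \<Rightarrow> nat) list \<Rightarrow> 'a::comm_monoid_add"
  assumes "\<beta> \<noteq> 0"
  shows "sum f (paths r \<beta>) =
    (\<Sum>i\<in>{i\<in>{1..r}. \<beta> i > 0}. \<Sum>p\<in>paths r (\<beta> - sroot i). f (p @ [\<beta>]))"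
proof -
  have disjoint: "(\<lambda>p. p @ [\<beta>]) ` paths r (\<beta> - sroot i) \<inter> (\<lambda>p. p @ [\<beta>]) ` paths r (\<beta> - sroot j) = {}"
    if "\<beta> i > 0" "\<beta> j > 0" "i \<noteq> j" for i j
  proof -
    have "(\<beta> - sroot i) i \<noteq> (\<beta> - sroot j) i"
      using that by (simp add: sroot_def)
    then have "\<beta> - sroot i \<noteq> \<beta> - sroot j"
      by metis
    then show ?thesis
      by (auto simp: paths_def)
  qed
  have "sum f (paths r \<beta>) =
      (\<Sum>i\<in>{i\<in>{1..r}. \<beta> i > 0}. sum f ((\<lambda>p. p @ [\<beta>]) ` paths r (\<beta> - sroot i)))"
    unfolding paths_eq_UN[OF assms]
    by (rule sum.UNION_disjoint) (use disjoint in \<open>auto simp: finite_paths\<close>)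
  then show ?thesis
    by (simp add: sum.reindex inj_on_def)
qed

lemma step_index_append:
  "1 \<le> k \<Longrightarrow> k < length p \<Longrightarrow> step_index r (p @ [\<beta>]) k = step_index r p k"
  by (simp add: step_index_def nth_append less_imp_diff_less)

lemma step_index_last:
  assumes "p \<in> paths r (\<beta> - sroot i)" "i \<in> {1..r}" "\<beta> i > 0"
  shows "step_index r (p @ [\<beta>]) (length p) = i"
proof (rule step_index_eq[OF assms(2)])
  have "(p @ [\<beta>]) ! (length p - 1) = \<beta> - sroot i"
    using assms by (auto simp: nth_append paths_def last_conv_nth)
  with assms(3) show "(p @ [\<beta>]) ! length p = (p @ [\<beta>]) ! (length p - 1) + sroot i"
    by (simp add: minus_sroot_add)
qed

lemma path_weight_append:
  assumes "p \<in> paths r (\<beta> - sroot i)" "i \<in> {1..r}" "\<beta> i > 0"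
  shows "path_weight r q h \<Lambda> (p @ [\<beta>]) = 1 / vi r q h \<Lambda> i \<beta> * path_weight r q h \<Lambda> p"
proof -
  have "p \<noteq> []"
    using assms by (auto simp: paths_def)
  then have "path_weight r q h \<Lambda> (p @ [\<beta>]) =
      (\<Prod>k=1..<length p. 1 / vi r q h \<Lambda> (step_index r (p @ [\<beta>]) k) ((p @ [\<beta>]) ! k)) *
      (1 / vi r q h \<Lambda> i \<beta>)"
    using step_index_last[OF assms] by (simp add: path_weight_def prod.atLeastLessThan_Suc Suc_le_eq)
  also have "(\<Prod>k=1..<length p. 1 / vi r q h \<Lambda> (step_index r (p @ [\<beta>]) k) ((p @ [\<beta>]) ! k)) =
      path_weight r q h \<Lambda> p"
    unfolding path_weight_def by (intro prod.cong) (auto simp: step_index_append nth_append)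
  finally show ?thesis
    by simp
qed

lemma path_vector_append:
  assumes "p \<in> paths r (\<beta> - sroot i)" "i \<in> {1..r}" "\<beta> i > 0"
  shows "path_vector r act vl (p @ [\<beta>]) = act (Fbar i) (path_vector r act vl p)"
proof -
  have "length p \<ge> 1"
    using assms by (cases p) (auto simp: paths_def)
  moreover have "fold (\<lambda>k. act (Fbar (step_index r (p @ [\<beta>]) k))) [1..<length p] vl =
      path_vector r act vl p"
    unfolding path_vector_def by (intro fold_cong) (auto simp: step_index_append)
  ultimately show ?thesis
    using step_index_last[OF assms] by (simp add: path_vector_def)
qed

text \<open>The shift is -1 for \<open>j = i + 1\<close>, +1 for \<open>i = j + 1\<close> and 0
  otherwise. Writing it through \<open>cartan j i\<close> matches the exponents compared in
  \<open>coefficient_exchange\<close>.\<close>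

lemma tau_step:
  assumes "i \<in> {1..r}" "j \<in> {1..r}"
  shows "tau r \<Lambda> i (\<beta> + sroot j) = tau r \<Lambda> i \<beta> + (of_nat j - of_nat i) * of_int (cartan j i)"
proof -
  have "tau r \<Lambda> i (\<beta> + sroot j) = tau r \<Lambda> i \<beta>
      - ((if i + 1 = j then 1 else 0) - (if i = j + 1 then 1 else 0))"
  proof -
    have "i + 1 \<le> Suc r" "i - 1 \<le> Suc r" "i - 1 = j \<longleftrightarrow> i = j + 1"
      using assms by auto
    then show ?thesis
      using assms by (simp add: tau_def wt_add wform_diff_left wform_add_left wform_diff_right
        sroot_fweight algebra_simps)
  qed
  then show ?thesis
    by (auto simp: cartan_def)
qed

section \<open>The vectors \<open>Z\<close> and the action of \<open>E\<^sub>j\<close> on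
  them\<close>

context uq_mod
begin

abbreviation Z :: "'v \<Rightarrow> (nat \<Rightarrow> nat) \<Rightarrow> 'v" where
  "Z vl \<equiv> Zvec r q h \<Lambda> scale act vl"

lemma Z_zero: "Z vl 0 = vl"
  by (simp add: Zvec_def paths_zero path_weight_def path_vector_def)

lemma Z_rec:
  assumes "\<beta> \<noteq> 0"
  shows "Z vl \<beta> = (\<Sum>i\<in>{i\<in>{1..r}. \<beta> i > 0}.
    scale (1 / vi r q h \<Lambda> i \<beta>) (act (Fbar i) (Z vl (\<beta> - sroot i))))"
  unfolding Zvec_def[of _ _ _ _ _ _ _ \<beta>] sum_paths[OF assms]
proof (rule sum.cong[OF refl])
  fix i assume "i \<in> {i\<in>{1..r}. \<beta> i > 0}"
  then show "(\<Sum>p\<in>paths r (\<beta> - sroot i). scale (path_weight r q h \<Lambda> (p @ [\<beta>]))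
      (path_vector r act vl (p @ [\<beta>]))) =
    scale (1 / vi r q h \<Lambda> i \<beta>) (act (Fbar i) (Z vl (\<beta> - sroot i)))"
    by (simp add: Zvec_def path_weight_append path_vector_append act_sum act_scale scale_sum_right
      del: times_divide_eq_left)
qed

lemma Z_wspace:
  assumes "vl \<in> wspace 0" "\<beta> \<in> Qplus r"
  shows "Z vl \<beta> \<in> wspace \<beta>"
  using assms(2)
proof (induction "height r \<beta>" arbitrary: \<beta> rule: less_induct)
  case less
  show ?case
  proof (cases "\<beta> = 0")
    case False
    show ?thesis
      unfolding Z_rec[OF False]
    proof (intro subspace_sum[OF subspace_wspace] subspace_scale[OF subspace_wspace])
      fix i assume i: "i \<in> {i\<in>{1..r}. \<beta> i > 0}"
      then have Zi: "Z vl (\<beta> - sroot i) \<in> wspace (\<beta> - sroot i)"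
        using less height_minus_sroot by (auto intro!: less.hyps Qplus_minus)
      then have "act (Fbar i) (Z vl (\<beta> - sroot i)) \<in> wspace (\<beta> - sroot i + sroot i)"
        using i by (auto simp: act_Fbar intro!: subspace_scale[OF subspace_wspace] act_F_wspace)
      with i show "act (Fbar i) (Z vl (\<beta> - sroot i)) \<in> wspace \<beta>"
        by (simp add: minus_sroot_add)
    qed
  qed (use assms in \<open>simp add: Z_zero\<close>)
qed

lemma E_Fbar:
  assumes v: "v \<in> wspace \<gamma>" and i: "i \<in> {1..r}" and j: "j \<in> {1..r}"
  shows "act (Eg j) (act (Fbar i) v) = scale (chi \<gamma> i ^ (i - 1)) (act (Fg i) (act (Eg j) v)) +
    (if i = j then scale (chi \<gamma> j ^ (j - 1) *
      ((chi \<gamma> j - inverse (chi \<gamma> j)) / (q - inverse q))) v else 0)"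
  using v i j by (auto simp: act_Fbar act_scale act_E_F_wspace scale_right_distrib)

text \<open>In exponents of \<open>q\<close>, with \<open>c\<close> the Cartan entry, the factors
  \<open>chi\<close> on the two sides differ by \<open>(j - i) * c\<close>, which is the change of
  \<open>tau\<close> under adding \<open>\<alpha>\<^sub>j\<close>. The powers \<open>i - 1\<close>
  in \<open>Fbar\<close> are what makes this balance.\<close>

lemma coefficient_exchange:
  assumes i: "i \<in> {1..r}" and j: "j \<in> {1..r}"
  shows "chi (\<delta> + sroot j) i ^ (i - 1) * chi \<delta> j ^ (j - 1)
      * qpow h (- tau r \<Lambda> i (\<delta> + sroot i + sroot j)) =
    chi \<delta> i ^ (i - 1) * chi (\<delta> + sroot i) j ^ (j - 1) * qpow h (- tau r \<Lambda> i (\<delta> + sroot i))"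
proof -
  define c where "c = complex_of_int (cartan j i)"
  define x where "x = (\<lambda>i. wform r (\<Lambda> - wt \<delta>) (wt (sroot i)))"
  have "cartan i j = cartan j i"
    by (auto simp: cartan_def)
  then have "wform r (wt (sroot j)) (wt (sroot i)) = c" "wform r (wt (sroot i)) (wt (sroot j)) = c"
    using i j by (simp_all add: wform_sroot_sroot c_def)
  then have chi: "chi \<delta> i = qpow h (x i)" "chi \<delta> j = qpow h (x j)"
    "chi (\<delta> + sroot j) i = qpow h (x i - c)" "chi (\<delta> + sroot i) j = qpow h (x j - c)"
    by (simp_all add: chi_def x_def wt_add wform_diff_left wform_add_left diff_diff_eq)
  have n: "of_nat (i - 1) = of_nat i - (1 :: complex)" "of_nat (j - 1) = of_nat j - (1 :: complex)"
    using i j by (auto simp: of_nat_diff)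
  have "of_nat (i - 1) * (x i - c) + of_nat (j - 1) * x j - tau r \<Lambda> i (\<delta> + sroot i + sroot j) =
    of_nat (i - 1) * x i + of_nat (j - 1) * (x j - c) - tau r \<Lambda> i (\<delta> + sroot i)"
    unfolding n tau_step[OF i j] c_def[symmetric] by (simp add: algebra_simps)
  then have "qpow h (of_nat (i - 1) * (x i - c) + of_nat (j - 1) * x j
      + - tau r \<Lambda> i (\<delta> + sroot i + sroot j)) =
    qpow h (of_nat (i - 1) * x i + of_nat (j - 1) * (x j - c) + - tau r \<Lambda> i (\<delta> + sroot i))"
    by simp
  then show ?thesis
    unfolding chi qpow_power qpow_add .
qed

text \<open>The summands in which \<open>E\<^sub>j\<close> passes \<open>F\<^sub>i\<close> recombine
  into \<open>Z\<close> at \<open>\<beta> - \<alpha>\<^sub>j\<close> with the factor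
  \<open>v\<^sub>q(\<beta> - \<alpha>\<^sub>j) / v\<^sub>q(\<beta>)\<close>. The commutator from
  \<open>i = j\<close> supplies by \<open>vq_step\<close> what is missing to 1; the common factor is
  the \<open>chi\<close> power.\<close>

lemma E_Z:
  assumes vl: "vl \<in> wspace 0" "\<And>i. i \<in> {1..r} \<Longrightarrow> act (Eg i) vl = 0"
    and vq: "\<And>\<beta>. \<beta> \<in> Qplus r \<Longrightarrow> \<beta> \<noteq> 0 \<Longrightarrow> vq r q h \<Lambda> \<beta> \<noteq> 0"
    and j: "j \<in> {1..r}" and \<beta>: "\<beta> \<in> Qplus r"
  shows "act (Eg j) (Z vl \<beta>) =
    (if \<beta> j > 0 then scale (chi (\<beta> - sroot j) j ^ (j - 1)) (Z vl (\<beta> - sroot j)) else 0)"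
  using \<beta>
proof (induction "height r \<beta>" arbitrary: \<beta> rule: less_induct)
  case less
  note \<beta> = less.prems
  show ?case
  proof (cases "\<beta> = 0")
    case True
    then show ?thesis
      using vl(2)[OF j] by (simp add: Z_zero)
  next
    case False
    define S where "S = (\<lambda>\<beta>. {i\<in>{1..r}. \<beta> i > (0 :: nat)})"
    have IH: "act (Eg j) (Z vl (\<beta> - sroot i)) = (if (\<beta> - sroot i) j > 0
        then scale (chi (\<beta> - sroot i - sroot j) j ^ (j - 1)) (Z vl (\<beta> - sroot i - sroot j)) else 0)"
      if "i \<in> S \<beta>" for i
      using that \<beta> height_minus_sroot by (intro less.hyps) (auto simp: S_def Qplus_minus)
    have w: "Z vl (\<beta> - \<gamma>) \<in> wspace (\<beta> - \<gamma>)" for \<gamma>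
      using Z_wspace[OF vl(1) Qplus_minus[OF \<beta>]] .
    have E: "act (Eg j) (Z vl \<beta>) = (\<Sum>i\<in>S \<beta>. scale (1 / vi r q h \<Lambda> i \<beta>)
        (act (Eg j) (act (Fbar i) (Z vl (\<beta> - sroot i)))))"
      unfolding Z_rec[OF False] S_def by (simp add: act_sum act_scale)
    show ?thesis
    proof (cases "\<beta> j > 0")
      case False
      \<comment> \<open>Here \<open>i\<close> differs from \<open>j\<close>, so there is no
        commutator, and the induction hypothesis gives 0 for the rest.\<close>
      have "act (Eg j) (act (Fbar i) (Z vl (\<beta> - sroot i))) = 0" if "i \<in> S \<beta>" for i
        using that False IH[OF that] j by (subst E_Fbar[OF w]) (auto simp: S_def)
      with False show ?thesis
        by (simp add: E)
    next
      case True
      define \<beta>' where "\<beta>' = \<beta> - sroot j"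
      define c where "c = chi \<beta>' j ^ (j - 1)"
      define b where "b = (chi \<beta>' j - inverse (chi \<beta>' j)) / (q - inverse q)"
      have \<beta>': "\<beta>' + sroot j = \<beta>" "\<beta>' \<in> Qplus r"
        using True \<beta> by (simp_all add: \<beta>'_def minus_sroot_add Qplus_minus)
      have nz: "vq r q h \<Lambda> \<beta> \<noteq> 0"
        using vq \<beta> \<open>\<beta> \<noteq> 0\<close> .
      have summand: "scale (1 / vi r q h \<Lambda> i \<beta>) (act (Eg j) (act (Fbar i) (Z vl (\<beta> - sroot i)))) =
          (if \<beta>' i > 0 then scale (c * vq r q h \<Lambda> \<beta>' / vq r q h \<Lambda> \<beta>)
            (scale (1 / vi r q h \<Lambda> i \<beta>') (act (Fbar i) (Z vl (\<beta>' - sroot i)))) else 0) +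
          (if i = j then scale (1 / vi r q h \<Lambda> j \<beta> * (c * b)) (Z vl \<beta>') else 0)"
        if i: "i \<in> S \<beta>" for i
      proof -
        define \<delta> where "\<delta> = \<beta>' - sroot i"
        have i1: "i \<in> {1..r}"
          using i by (simp add: S_def)
        have comm: "\<beta> - sroot i - sroot j = \<delta>"
          by (simp add: \<delta>_def \<beta>'_def fun_eq_iff add.commute)
        \<comment> \<open>Both sides say that \<open>\<alpha>\<^sub>i\<close> and
          \<open>\<alpha>\<^sub>j\<close> can be removed from \<open>\<beta>\<close> together; for
          \<open>i = j\<close> this means a coordinate of at least 2.\<close>
        have pos: "(\<beta> - sroot i) j > 0 \<longleftrightarrow> \<beta>' i > 0"
          using True i by (auto simp: \<beta>'_def S_def sroot_def)
        have first: "scale (1 / vi r q h \<Lambda> i \<beta>) (scale (chi (\<beta> - sroot i) i ^ (i - 1))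
            (act (Fg i) (act (Eg j) (Z vl (\<beta> - sroot i))))) =
          scale (c * vq r q h \<Lambda> \<beta>' / vq r q h \<Lambda> \<beta>)
            (scale (1 / vi r q h \<Lambda> i \<beta>') (act (Fbar i) (Z vl \<delta>)))" if "\<beta>' i > 0"
        proof -
          have \<beta>'i: "\<beta>' = \<delta> + sroot i"
            using that by (simp add: \<delta>_def minus_sroot_add)
          have \<beta>i: "\<beta> - sroot i = \<delta> + sroot j"
            using \<beta>'(1) by (auto simp: \<beta>'i)
          have "\<beta>' \<noteq> 0"
            using that by auto
          then have nz': "vq r q h \<Lambda> \<beta>' \<noteq> 0"
            using vq \<beta>'(2) by simp
          have "Z vl \<delta> \<in> wspace \<delta>"
            using \<beta>'(2) by (intro Z_wspace vl) (simp add: \<delta>_def Qplus_minus)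
          then have F: "act (Fbar i) (Z vl \<delta>) = scale (chi \<delta> i ^ (i - 1)) (act (Fg i) (Z vl \<delta>))"
            using i1 by (rule act_Fbar)
          have "1 / vi r q h \<Lambda> i \<beta> * (chi (\<delta> + sroot j) i ^ (i - 1) * chi \<delta> j ^ (j - 1)) =
              (chi (\<delta> + sroot j) i ^ (i - 1) * chi \<delta> j ^ (j - 1)
                * qpow h (- tau r \<Lambda> i (\<delta> + sroot i + sroot j))) / vq r q h \<Lambda> \<beta>"
            using \<beta>'(1) by (simp add: vi_def \<beta>'i qpow_minus divide_inverse mult_ac)
          also have "\<dots> = (chi \<delta> i ^ (i - 1) * c * qpow h (- tau r \<Lambda> i \<beta>')) / vq r q h \<Lambda> \<beta>"
            using coefficient_exchange[OF i1 j, of \<delta>] by (simp add: c_def \<beta>'i)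
          also have "\<dots> = c * vq r q h \<Lambda> \<beta>' / vq r q h \<Lambda> \<beta> * (1 / vi r q h \<Lambda> i \<beta>' * chi \<delta> i ^ (i - 1))"
            using nz' by (simp add: vi_def qpow_minus divide_inverse mult_ac)
          finally show ?thesis
            using IH[OF i] pos that comm
            by (simp only: if_True F act_scale scale_scale \<beta>i mult.assoc)
        qed
        have "i = j \<Longrightarrow> \<beta> - sroot i = \<beta>'"
          by (simp add: \<beta>'_def)
        with first pos IH[OF i] show ?thesis
          unfolding E_Fbar[OF w i1 j] \<delta>_def[symmetric]
          by (auto simp: scale_right_distrib c_def b_def)
      qed
      have "act (Eg j) (Z vl \<beta>) =
          (\<Sum>i\<in>S \<beta>. if \<beta>' i > 0 then scale (c * vq r q h \<Lambda> \<beta>' / vq r q h \<Lambda> \<beta>)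
            (scale (1 / vi r q h \<Lambda> i \<beta>') (act (Fbar i) (Z vl (\<beta>' - sroot i)))) else 0) +
          (\<Sum>i\<in>S \<beta>. if i = j then scale (1 / vi r q h \<Lambda> j \<beta> * (c * b)) (Z vl \<beta>') else 0)"
        unfolding E sum.distrib[symmetric] by (intro sum.cong refl summand)
      also have "(\<Sum>i\<in>S \<beta>. if i = j then scale (1 / vi r q h \<Lambda> j \<beta> * (c * b)) (Z vl \<beta>') else 0) =
          scale (1 / vi r q h \<Lambda> j \<beta> * (c * b)) (Z vl \<beta>')"
        using True j by (simp add: S_def)
      also have "(\<Sum>i\<in>S \<beta>. if \<beta>' i > 0 then scale (c * vq r q h \<Lambda> \<beta>' / vq r q h \<Lambda> \<beta>)
            (scale (1 / vi r q h \<Lambda> i \<beta>') (act (Fbar i) (Z vl (\<beta>' - sroot i)))) else 0) =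
          (\<Sum>i\<in>S \<beta>'. scale (c * vq r q h \<Lambda> \<beta>' / vq r q h \<Lambda> \<beta>)
            (scale (1 / vi r q h \<Lambda> i \<beta>') (act (Fbar i) (Z vl (\<beta>' - sroot i)))))"
        \<comment> \<open>Only \<open>j\<close> can drop out of the index set, namely when
          \<open>\<beta> j = 1\<close>, and its summand is then 0.\<close>
        by (intro sum.mono_neutral_cong_right) (auto simp: S_def \<beta>'_def)
      also have "\<dots> = scale (c * vq r q h \<Lambda> \<beta>' / vq r q h \<Lambda> \<beta>) (Z vl \<beta>')"
      \<comment> \<open>At 0 there is no recursion for \<open>Z\<close>, but the sum is empty and
        the factor \<open>vq r q h \<Lambda> 0\<close> vanishes.\<close>
      proof (cases "\<beta>' = 0")
        case True
        then show ?thesis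
          by (simp add: S_def)
      next
        case False
        then show ?thesis
          by (simp only: Z_rec[OF False] S_def flip: scale_sum_right)
      qed
      also have "\<dots> + scale (1 / vi r q h \<Lambda> j \<beta> * (c * b)) (Z vl \<beta>') =
          scale (c * vq r q h \<Lambda> \<beta>' / vq r q h \<Lambda> \<beta> + 1 / vi r q h \<Lambda> j \<beta> * (c * b)) (Z vl \<beta>')"
        by (simp add: scale_left_distrib)
      also have "c * vq r q h \<Lambda> \<beta>' / vq r q h \<Lambda> \<beta> + 1 / vi r q h \<Lambda> j \<beta> * (c * b) = c"
      proof -
        have "vq r q h \<Lambda> \<beta> = vq r q h \<Lambda> \<beta>' + qpow h (- tau r \<Lambda> j \<beta>) * b"
          using vq_step[OF j exp_h, of \<Lambda> \<beta>'] not_root_of_unity[of 2] by (simp add: \<beta>' b_def chi_def)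
        then have "qpow h (- tau r \<Lambda> j \<beta>) * b = vq r q h \<Lambda> \<beta> - vq r q h \<Lambda> \<beta>'"
          by simp
        moreover have "1 / vi r q h \<Lambda> j \<beta> * (c * b) = c * (qpow h (- tau r \<Lambda> j \<beta>) * b) / vq r q h \<Lambda> \<beta>"
          by (simp add: vi_def qpow_minus divide_inverse mult_ac)
        ultimately show ?thesis
          using nz by (simp add: diff_divide_distrib right_diff_distrib)
      qed
      finally show ?thesis
        using True by (simp only: c_def \<beta>'_def if_True)
    qed
  qed
qed

end

section \<open>Whittaker vectors\<close>

locale irreducible_verma = uq_mod r q h \<Lambda> scale act
  for r q h \<Lambda> and scale :: "complex \<Rightarrow> 'v::ab_group_add \<Rightarrow> 'v" and act +
  fixes vl :: 'v
  assumes irreducible: "irreducible_module scale act"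
    and vl_nonzero: "vl \<noteq> 0"
    and vl_wspace: "vl \<in> wspace 0"
    and E_vl: "\<And>i. i \<in> {1..r} \<Longrightarrow> act (Eg i) vl = 0"
begin

text \<open>Irreducibility provides the spanning of the module by \<open>F\<close>-words on
  \<open>vl\<close>; the structure of its weight spaces is read off from these words.\<close>

lemma fspan_vl: "fspan vl 0 = UNIV"
  by (rule singular_vector_generates[OF irreducible vl_nonzero vl_wspace E_vl])

lemma wspace_span:
  assumes "v \<in> wspace \<beta>" "\<beta> \<in> Qplus r"
  shows "v \<in> span {v. fword vl 0 \<beta> v}"
  using fspan_wspace[of v vl 0 \<beta>] assms vl_wspace by (simp add: fspan_vl)

text \<open>The highest weight space is a line, as the empty word is the only one of depth 0. This
  is what gives \<open>bra\<close> a value.\<close>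

lemma wspace_zeroE:
  assumes "v \<in> wspace 0"
  obtains c where "v = scale c vl"
proof -
  have "{v. fword vl 0 0 v} \<subseteq> {vl}"
    using fword_same by blast
  from span_mono[OF this] wspace_span[OF assms zero_Qplus] have "v \<in> span {vl}"
    by (rule subsetD)
  then show ?thesis
    using that by (auto simp: span_singleton)
qed

lemma E_vanish:
  assumes "v \<in> wspace \<beta>" "\<beta> \<in> Qplus r" "i \<in> {1..r}" "\<beta> i = 0"
  shows "act (Eg i) v = 0"
proof -
  have "act (Eg i) v \<in> {0}"
    using wspace_span[OF assms(1,2)]
  proof (rule act_span)
    show "act (Eg i) v \<in> {0}" if "v \<in> {v. fword vl 0 \<beta> v}" for v
      using that fword_E_vanish[OF _ vl_wspace E_vl] assms(3,4) by auto
  qed (rule subspace_single_0)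
  then show ?thesis
    by simp
qed

text \<open>A nonzero such vector would generate the whole module, but words on it have depth at
  least \<open>\<beta>\<close> and so never reach \<open>vl\<close> at depth 0.\<close>

lemma singular_vector_zero:
  assumes "v \<in> wspace \<beta>" "\<beta> \<in> Qplus r" "\<beta> \<noteq> 0" "\<And>i. i \<in> {1..r} \<Longrightarrow> act (Eg i) v = 0"
  shows "v = 0"
proof (rule ccontr)
  assume "v \<noteq> 0"
  then have "fspan v \<beta> = UNIV"
    by (rule singular_vector_generates[OF irreducible _ assms(1,4)])
  then have "vl \<in> span {u. fword v \<beta> 0 u}"
    using fspan_wspace[of vl v \<beta> 0] vl_wspace assms by simp
  moreover have "\<not> \<beta> \<le> 0"
    using assms(3) by (auto simp: le_fun_def fun_eq_iff)
  then have "{u. fword v \<beta> 0 u} = {}"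
    using fword_le by blast
  ultimately show False
    using vl_nonzero by simp
qed

section \<open>Whittaker vectors in components, their uniqueness and existence\<close>

lemma bra_scale: "w 0 = scale c vl \<Longrightarrow> bra scale vl w = c"
  unfolding bra_def using vl_nonzero by (intro the_equality) auto

lemma compl_K_pow: "(compl_K act i ^^ n) w \<beta> = act (Kg i ^ n) (w \<beta>)"
  by (induction n arbitrary: \<beta>) (simp_all add: compl_K_def act_mult)

text \<open>On a weight space \<open>K\<^sub>i\<close> is a scalar, and outside the cone both sides
  of the Whittaker equation are 0, so only the equations at \<open>\<beta>\<close> in the cone
  remain.\<close>

lemma whittaker_vector_iff:
  "whittaker_vector r h \<Lambda> scale act vl \<mu> w \<longleftrightarrow>
    (\<forall>\<beta>\<in>Qplus r. w \<beta> \<in> wspace \<beta>) \<and> (\<forall>\<beta>. \<beta> \<notin> Qplus r \<longrightarrow> w \<beta> = 0) \<and> w 0 = vl \<and>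
    (\<forall>i\<in>{1..r}. \<forall>\<beta>\<in>Qplus r.
      act (Eg i) (w (\<beta> + sroot i)) = scale (\<mu> i * chi \<beta> i ^ (i - 1)) (w \<beta>))"
proof -
  have "bra scale vl w = 1 \<longleftrightarrow> w 0 = vl" if "w \<in> completion r h \<Lambda> scale act"
  proof -
    have "w 0 \<in> wspace 0"
      using that zero_Qplus by (auto simp only: completion_def weight_space_eq mem_Collect_eq)
    then obtain c where "w 0 = scale c vl"
      by (rule wspace_zeroE)
    with bra_scale[of w c] bra_scale[of w 1] show ?thesis
      by auto
  qed
  moreover have "compl_E act i w = (\<lambda>\<beta>. scale (\<mu> i) ((compl_K act i ^^ (i - 1)) w \<beta>)) \<longleftrightarrow>
    (\<forall>\<beta>\<in>Qplus r. act (Eg i) (w (\<beta> + sroot i)) = scale (\<mu> i * chi \<beta> i ^ (i - 1)) (w \<beta>))"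
    if w: "w \<in> completion r h \<Lambda> scale act" and i: "i \<in> {1..r}" for i
  proof -
    have "act (Eg i) (w (\<beta> + sroot i)) = scale (\<mu> i) (act (Kg i ^ (i - 1)) (w \<beta>))"
      if "\<beta> \<notin> Qplus r" for \<beta>
      using that w i by (simp add: completion_def Qplus_add_sroot_iff)
    moreover have "act (Kg i ^ (i - 1)) (w \<beta>) = scale (chi \<beta> i ^ (i - 1)) (w \<beta>)"
      if "\<beta> \<in> Qplus r" for \<beta>
      using that w by (intro act_K_pow i) (simp add: completion_def weight_space_eq)
    ultimately show ?thesis
      unfolding compl_E_def compl_K_pow fun_eq_iff by (metis scale_scale)
  qed
  ultimately show ?thesis
    unfolding whittaker_vector_def by (auto simp: completion_def weight_space_eq)
qed

text \<open>By induction on the height: once the components below \<open>\<beta>\<close> agree, the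
  Whittaker equations make the difference at \<open>\<beta>\<close> a singular vector, and at
  \<open>\<beta> = 0\<close> both components are \<open>vl\<close>.\<close>

lemma whittaker_vector_unique:
  assumes w: "whittaker_vector r h \<Lambda> scale act vl \<mu> w"
    and w': "whittaker_vector r h \<Lambda> scale act vl \<mu> w'"
  shows "w = w'"
proof
  fix \<beta>
  note W = w[unfolded whittaker_vector_iff] w'[unfolded whittaker_vector_iff]
  have "w \<beta> = w' \<beta>" if "\<beta> \<in> Qplus r"
    using that
  proof (induction "height r \<beta>" arbitrary: \<beta> rule: less_induct)
    case less
    have d: "w \<beta> - w' \<beta> \<in> wspace \<beta>"
      using W less.prems by (intro subspace_diff[OF subspace_wspace]) auto
    have "act (Eg i) (w \<beta> - w' \<beta>) = 0" if i: "i \<in> {1..r}" for i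
    proof (cases "\<beta> i > 0")
      case True
      then have "w (\<beta> - sroot i) = w' (\<beta> - sroot i)"
        using i less height_minus_sroot Qplus_minus by blast
      moreover have "\<beta> - sroot i \<in> Qplus r"
        using less.prems by (rule Qplus_minus)
      then have
        "act (Eg i) (u \<beta>) = scale (\<mu> i * chi (\<beta> - sroot i) i ^ (i - 1)) (u (\<beta> - sroot i))"
        if "u \<in> {w, w'}" for u
        using W i that minus_sroot_add[of \<beta> i, OF True] by fastforce
      ultimately show ?thesis
        by (simp add: act_diff)
    next
      case False
      \<comment> \<open>With \<open>\<beta> i = 0\<close> no Whittaker equation for \<open>i\<close>
        involves the component at \<open>\<beta>\<close>; the weight alone forces the
        vanishing.\<close>
      with E_vanish[OF d less.prems i] show ?thesis
        by simp
    qed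
    with singular_vector_zero[OF d less.prems] W show ?case
      by (cases "\<beta> = 0") auto
  qed
  then show "w \<beta> = w' \<beta>"
    using W by (cases "\<beta> \<in> Qplus r") auto
qed

text \<open>Passing from \<open>\<beta>\<close> to \<open>\<beta> + sroot i\<close> multiplies the
  monomial in \<open>\<mu>\<close> by exactly the \<open>\<mu> i\<close> demanded by the equation;
  the rest is \<open>E_Z\<close>.\<close>

lemma whittaker_path_sum:
  assumes "\<And>\<beta>. \<beta> \<in> Qplus r \<Longrightarrow> \<beta> \<noteq> 0 \<Longrightarrow> vq r q h \<Lambda> \<beta> \<noteq> 0"
  shows "whittaker_vector r h \<Lambda> scale act vl \<mu> (path_sum r q h \<Lambda> scale act vl \<mu>)"
  unfolding whittaker_vector_iff
proof (intro conjI ballI)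
  fix i \<beta>
  assume i: "i \<in> {1..r}" and \<beta>: "\<beta> \<in> Qplus r"
  have "(\<Prod>k=1..r. \<mu> k ^ (\<beta> + sroot i) k) =
      (\<Prod>k=1..r. \<mu> k ^ \<beta> k) * (\<Prod>k=1..r. if k = i then \<mu> k else 1)"
    unfolding prod.distrib[symmetric] by (intro prod.cong) (auto simp: sroot_def)
  also have "(\<Prod>k=1..r. if k = i then \<mu> k else 1) = \<mu> i"
    using i by simp
  finally have "(\<Prod>k=1..r. \<mu> k ^ (\<beta> + sroot i) k) = (\<Prod>k=1..r. \<mu> k ^ \<beta> k) * \<mu> i" .
  moreover have "act (Eg i) (Z vl (\<beta> + sroot i)) = scale (chi \<beta> i ^ (i - 1)) (Z vl \<beta>)"
    using E_Z[OF vl_wspace E_vl assms i Qplus_add_sroot[OF \<beta> i]] by (simp add: sroot_def)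
  ultimately show "act (Eg i) (path_sum r q h \<Lambda> scale act vl \<mu> (\<beta> + sroot i)) =
      scale (\<mu> i * chi \<beta> i ^ (i - 1)) (path_sum r q h \<Lambda> scale act vl \<mu> \<beta>)"
    using i \<beta> by (simp add: path_sum_def Qplus_add_sroot act_scale mult_ac)
qed (auto simp: path_sum_def Z_zero intro!: subspace_scale[OF subspace_wspace] Z_wspace vl_wspace)

end

theorem theorem6p12:
  fixes r :: nat and q h :: complex and \<Lambda> \<mu> :: "nat \<Rightarrow> complex"
    and scale :: "complex \<Rightarrow> 'v::ab_group_add \<Rightarrow> 'v"
    and act :: "freealg \<Rightarrow> 'v \<Rightarrow> 'v" and vl :: 'v
  assumes "r \<ge> 1"
    and "exp h = q"
    and "verma_module r q h \<Lambda> scale act vl"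
    and "generic r q h \<Lambda> scale act"
    and "\<forall>i\<in>{1..r}. \<mu> i \<noteq> 0"
  shows "(\<exists>!w. whittaker_vector r h \<Lambda> scale act vl \<mu> w) \<and>
    whittaker_vector r h \<Lambda> scale act vl \<mu> (path_sum r q h \<Lambda> scale act vl \<mu>)"
proof -
  interpret uq_mod r q h \<Lambda> scale act
    using assms by unfold_locales (auto simp: verma_module_def generic_def)
  have ideal: "act x vl = 0" if "x \<in> verma_ideal r q h \<Lambda>" for x
    using assms(3) that by (auto simp: verma_module_def)
  interpret irreducible_verma r q h \<Lambda> scale act vl
  proof
    show irr: "irreducible_module scale act"
      using assms(4) by (simp add: generic_def)
    show "vl \<noteq> 0"
    proof
      \<comment> \<open>The module is cyclic on \<open>vl\<close>, so it would be zero, which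
        irreducibility excludes.\<close>
      assume "vl = 0"
      then have "v = 0" for v :: 'v
        using assms(3) by (simp add: verma_module_def)
      with irr show False
        by (auto simp: irreducible_module_def)
    qed
    show "vl \<in> wspace 0"
      using ideal[OF verma_ideal.K[of _ r 1]]
      by (auto simp: wspace_def chi_def act_diff_left act_const)
    show "act (Eg i) vl = 0" if "i \<in> {1..r}" for i
      using ideal[OF verma_ideal.E[OF that, of 1]] by simp
  qed
  have "whittaker_vector r h \<Lambda> scale act vl \<mu> (path_sum r q h \<Lambda> scale act vl \<mu>)"
    using assms(4) by (intro whittaker_path_sum) (auto simp: generic_def)
  then show ?thesis
    using whittaker_vector_unique by blast
qed

end
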